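(* Let $G\le\mathrm{O}(d)$ have closed orbits. The following are equivalent: (a) the max filtering map $K([x],[y]):=\langle\!\langle[x],[y]\rangle\!\rangle$ is a positive definite kernel on $\mathbb{R}^d/G$; (b) $G$ is polar with a section $\Sigma$ such that $\mathbb{R}^d/G$ is isometric to $\Sigma/W(\Sigma,G)$, and furthermore $W(\Sigma,G)$ is a finite reflection group (acting on $\Sigma$).
   Context: For $x\in\mathbb{R}^d$, $[x]:=\{gx:g\in G\}$; $\mathbb{R}^d/G$ carries the quotient metric $d([x],[y]):=\inf_{p\in[x],q\in[y]}\|p-q\|$, and $\langle\!\langle[x],[y]\rangle\!\rangle:=\sup_{p\in[x],q\in[y]}\langle p,q\rangle$. A positive definite kernel on a set $\mathcal{X}$ is a symmetric $K:\mathcal{X}\times\mathcal{X}\to\mathbb{R}$ with $\sum_{i,j=1}^nc_ic_jK(x_i,x_j)\ge0$ for all $n$, $x_i\in\mathcal{X}$, $c_i\in\mathbb{R}$. $G$ is polar if there is a linear subspace $\Sigma\le\mathbb{R}^d$ (a section) meeting every orbit orthogonally: $G\cdot\Sigma=\mathbb{R}^d$ and for every $x\in\Sigma$ the tangent space at $x$ of the orbit $[x]$ (a smooth submanifold) lies in $\Sigma^\perp$. $W(\Sigma,G)$ is the largest subgroup of $G$ leaving $\Sigma$ invariant, acting on $\Sigma$ by restriction; $\Sigma/W(\Sigma,G)$ carries the analogous quotient metric. A finite reflection group is a finite group of orthogonal maps generated by reflections across hyperplanes. *)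

theory Defs
  imports "HOL-Analysis.Analysis" "HOL-Library.FuncSet"
begin

definition orth_group :: "('a::euclidean_space \<Rightarrow> 'a) set \<Rightarrow> bool" where
  "orth_group G \<longleftrightarrow> id \<in> G \<and> (\<forall>g\<in>G. orthogonal_transformation g)
     \<and> (\<forall>g\<in>G. \<forall>h\<in>G. g \<circ> h \<in> G) \<and> (\<forall>g\<in>G. inv g \<in> G)"

definition orb :: "('a \<Rightarrow> 'a) set \<Rightarrow> 'a \<Rightarrow> 'a set" where
  "orb G x = (\<lambda>g. g x) ` G"

definition qdist :: "'a::metric_space set \<Rightarrow> 'a set \<Rightarrow> real" where
  "qdist A B = Inf {dist p q | p q. p \<in> A \<and> q \<in> B}"

definition maxfilt :: "'a::real_inner set \<Rightarrow> 'a set \<Rightarrow> real" where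
  "maxfilt A B = Sup {p \<bullet> q | p q. p \<in> A \<and> q \<in> B}"

definition pd_kernel_on :: "'b set \<Rightarrow> ('b \<Rightarrow> 'b \<Rightarrow> real) \<Rightarrow> bool" where
  "pd_kernel_on X K \<longleftrightarrow> (\<forall>x\<in>X. \<forall>y\<in>X. K x y = K y x) \<and>
     (\<forall>(n::nat) (xs::nat \<Rightarrow> 'b) (c::nat \<Rightarrow> real). (\<forall>i<n. xs i \<in> X) \<longrightarrow>
        (\<Sum>i<n. \<Sum>j<n. c i * c j * K (xs i) (xs j)) \<ge> 0)"

definition tangent_space :: "'a::real_normed_vector set \<Rightarrow> 'a \<Rightarrow> 'a set" where
  "tangent_space M x = {v. \<exists>\<gamma>::real \<Rightarrow> 'a. (\<forall>t. \<gamma> t \<in> M) \<and> \<gamma> 0 = x \<and>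
        (\<gamma> has_vector_derivative v) (at 0)}"

definition is_section :: "('a::euclidean_space \<Rightarrow> 'a) set \<Rightarrow> 'a set \<Rightarrow> bool" where
  "is_section G \<Sigma> \<longleftrightarrow> subspace \<Sigma> \<and> (\<Union>g\<in>G. g ` \<Sigma>) = UNIV \<and>
     (\<forall>x\<in>\<Sigma>. \<forall>v\<in>tangent_space (orb G x) x. \<forall>s\<in>\<Sigma>. orthogonal v s)"

definition polar :: "('a::euclidean_space \<Rightarrow> 'a) set \<Rightarrow> bool" where
  "polar G \<longleftrightarrow> (\<exists>\<Sigma>. is_section G \<Sigma>)"

definition weyl :: "('a \<Rightarrow> 'a) set \<Rightarrow> 'a set \<Rightarrow> ('a \<Rightarrow> 'a) set" where
  "weyl G \<Sigma> = {g \<in> G. g ` \<Sigma> = \<Sigma>}"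

definition is_reflection_on :: "'a::euclidean_space set \<Rightarrow> ('a \<Rightarrow> 'a) \<Rightarrow> bool" where
  "is_reflection_on \<Sigma> r \<longleftrightarrow> (\<exists>v\<in>\<Sigma>. v \<noteq> 0 \<and>
      r = restrict (\<lambda>x. x - (2 * (x \<bullet> v) / (v \<bullet> v)) *\<^sub>R v) \<Sigma>)"

inductive_set generated_on :: "'a set \<Rightarrow> ('a \<Rightarrow> 'a) set \<Rightarrow> ('a \<Rightarrow> 'a) set"
  for \<Sigma> :: "'a set" and S :: "('a \<Rightarrow> 'a) set" where
  gen_id: "restrict id \<Sigma> \<in> generated_on \<Sigma> S"
| gen_step: "f \<in> generated_on \<Sigma> S \<Longrightarrow> s \<in> S \<Longrightarrow> restrict (s \<circ> f) \<Sigma> \<in> generated_on \<Sigma> S"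

definition finite_reflection_group_on :: "'a::euclidean_space set \<Rightarrow> ('a \<Rightarrow> 'a) set \<Rightarrow> bool" where
  "finite_reflection_group_on \<Sigma> R \<longleftrightarrow> finite R \<and>
     (\<exists>S. (\<forall>r\<in>S. is_reflection_on \<Sigma> r) \<and> R = generated_on \<Sigma> S)"

end

theory Submission
  imports Defs
begin

text \<open>
  Write \<open>K\<close> for max filtering on vectors and call \<open>x\<close>, \<open>y\<close> aligned if \<open>K x y\<close> is their inner product.

  If \<open>K\<close> is positive definite, then \<open>K (x + y) u = K x u + K y u\<close> for aligned \<open>x\<close>, \<open>y\<close>, because the
  feature vectors of \<open>x\<close> and \<open>y\<close> add up to that of \<open>x + y\<close>. Hence a vector is aligned with a finite
  sum of pairwise aligned vectors iff it is aligned with every summand, and by compactness of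
  the orbits a maximal pairwise aligned set \<open>A\<close> meets every orbit, in exactly one point. Its span
  is the section. Since the closure of the group is a compact Lie group, \<open>g y\<close> can be reached from
  \<open>y\<close> by an isometry \<open>h\<close> whose distance to the identity is \<open>O(|g y - y|)\<close>. For \<open>a\<close>, \<open>b\<close> in \<open>A\<close> the
  numbers \<open>\<langle>a - h a, b\<rangle>\<close> and \<open>\<langle>a - h\<inverse> a, b\<rangle>\<close> are nonnegative with sum \<open>\<langle>h a - a, h b - b\<rangle>\<close>, so both
  are of second order; by bilinearity this second-order bound holds on the whole span. It makes
  orbits orthogonal to the section and shows that the translates of \<open>A\<close> tile the section. The
  walls of \<open>A\<close> then yield reflections, which generate the Weyl group.

  Conversely, a Weyl chamber of a finite reflection group is an isometric copy of the quotient
  in Euclidean space, and a quotient that embeds isometrically into an inner product space has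
  a positive definite max filtering kernel by polarization.
\<close>

subsection \<open>Reflections and chambers\<close>

text \<open>For \<open>v = 0\<close> division by zero makes this the identity, so most of the
  algebraic laws below need no side condition on \<open>v\<close>.\<close>

definition hrefl :: "'a::euclidean_space \<Rightarrow> 'a \<Rightarrow> 'a" where
  "hrefl v x = x - (2 * (x \<bullet> v) / (v \<bullet> v)) *\<^sub>R v"

lemma hrefl_add: "hrefl v (x + y) = hrefl v x + hrefl v y"
  by (simp add: hrefl_def algebra_simps inner_add_left add_divide_distrib)

lemma hrefl_scaleR: "hrefl v (c *\<^sub>R x) = c *\<^sub>R hrefl v x"
  by (simp add: hrefl_def algebra_simps)

lemma hrefl_minus: "hrefl v (- x) = - hrefl v x"
  using hrefl_scaleR[of v "-1" x] by simp

lemma hrefl_inner: "hrefl v x \<bullet> hrefl v y = x \<bullet> y"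
proof (cases "v = 0")
  case False
  then show ?thesis
    by (simp add: hrefl_def inner_diff_left inner_diff_right inner_commute field_simps)
qed (simp add: hrefl_def)

lemma hrefl_hrefl [simp]: "hrefl v (hrefl v x) = x"
proof (cases "v = 0")
  case False
  then have "hrefl v x \<bullet> v = - (x \<bullet> v)"
    by (simp add: hrefl_def inner_diff_left)
  then show ?thesis
    by (simp add: hrefl_def)
qed (simp add: hrefl_def)

lemma hrefl_inner_swap: "hrefl v x \<bullet> y = x \<bullet> hrefl v y"
  by (metis hrefl_hrefl hrefl_inner)

lemma hrefl_self: "hrefl v v = - v"
  by (cases "v = 0") (simp_all add: hrefl_def algebra_simps scaleR_2[symmetric])

lemma hrefl_neg [simp]: "hrefl (- v) = hrefl v"
  by (simp add: hrefl_def fun_eq_iff)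

lemma norm_hrefl [simp]: "norm (hrefl v x) = norm x"
  by (simp add: norm_eq_sqrt_inner hrefl_inner)

lemma hrefl_fixes: "x \<bullet> v = 0 \<Longrightarrow> hrefl v x = x"
  by (simp add: hrefl_def)

lemma hrefl_in_subspace: "subspace S \<Longrightarrow> v \<in> S \<Longrightarrow> x \<in> S \<Longrightarrow> hrefl v x \<in> S"
  by (simp add: hrefl_def subspace_diff subspace_scale)

lemma hrefl_conj: "hrefl (hrefl a v) x = hrefl a (hrefl v (hrefl a x))"
proof -
  have "hrefl a (hrefl v (hrefl a x)) =
     hrefl a (hrefl a x) - hrefl a ((2 * (hrefl a x \<bullet> v) / (v \<bullet> v)) *\<^sub>R v)"
    by (subst hrefl_def[of v])
       (metis (no_types, lifting) hrefl_add hrefl_minus uminus_add_conv_diff add.commute)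
  then show ?thesis
    by (simp add: hrefl_scaleR hrefl_def[of "hrefl a v"] hrefl_inner hrefl_inner_swap)
qed

text \<open>Take a subset of least cardinality cutting out the same cone. Dropping \<open>v\<close>
  from it enlarges the cone, and a point gained in this way violates the inequality of
  \<open>v\<close> only. Pulling it towards the interior point \<open>\<rho>\<close> until it meets
  the hyperplane of \<open>v\<close> gives a point inside the facet. The lemma serves both simple
  roots and the walls of \<open>A\<close>.\<close>

lemma facet_points:
  fixes N :: "'a::euclidean_space set"
  assumes S: "subspace S" and fin: "finite N" and \<rho>: "\<rho> \<in> S" "\<And>v. v \<in> N \<Longrightarrow> \<rho> \<bullet> v > 0"
  obtains N' where "N' \<subseteq> N"
    and "{u \<in> S. \<forall>v\<in>N'. 0 \<le> u \<bullet> v} = {u \<in> S. \<forall>v\<in>N. 0 \<le> u \<bullet> v}"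
    and "\<And>v. v \<in> N' \<Longrightarrow> \<exists>p\<in>S. p \<bullet> v = 0 \<and> (\<forall>v'\<in>N' - {v}. p \<bullet> v' > 0)"
proof -
  define C where "C M = {u \<in> S. \<forall>v\<in>M. 0 \<le> u \<bullet> v}" for M
  obtain M where M: "M \<subseteq> N" "C M = C N"
    and min: "\<And>M'. M' \<subseteq> N \<Longrightarrow> C M' = C N \<Longrightarrow> card M \<le> card M'"
    using ex_has_least_nat[of "\<lambda>M. M \<subseteq> N \<and> C M = C N" N card] by auto
  have finM: "finite M" using M fin finite_subset by blast
  have facet: "\<exists>p\<in>S. p \<bullet> v = 0 \<and> (\<forall>v'\<in>M - {v}. p \<bullet> v' > 0)" if v: "v \<in> M" for v
  proof -
    have "C (M - {v}) \<noteq> C N"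
      using min[of "M - {v}"] M v finM by (metis Diff_subset card_Diff1_less leD subset_trans)
    moreover have "C N \<subseteq> C (M - {v})" using M by (auto simp: C_def)
    ultimately obtain q where q: "q \<in> C (M - {v})" "q \<notin> C M" using M by blast
    then have qS: "q \<in> S" and qv': "\<And>v'. v' \<in> M - {v} \<Longrightarrow> q \<bullet> v' \<ge> 0"
      by (auto simp: C_def)
    have qv: "q \<bullet> v < 0"
    proof (rule ccontr)
      assume "\<not> q \<bullet> v < 0"
      then have "\<forall>v'\<in>M. 0 \<le> q \<bullet> v'" using qv' by (metis DiffI not_less singletonD)
      then show False using q(2) qS by (simp add: C_def)
    qed
    \<comment> \<open>Up to a positive factor, the point where the segment from \<open>q\<close> to
      \<open>\<rho>\<close> crosses the hyperplane orthogonal to \<open>v\<close>.\<close>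
    define p where "p = (- (q \<bullet> v)) *\<^sub>R \<rho> + (\<rho> \<bullet> v) *\<^sub>R q"
    have rv: "\<rho> \<bullet> v > 0" using \<rho> v M by blast
    have "p \<bullet> v' > 0" if "v' \<in> M - {v}" for v'
    proof -
      have "\<rho> \<bullet> v' > 0" using \<rho> that M by blast
      then have "(- (q \<bullet> v)) * (\<rho> \<bullet> v') > 0" using qv by (intro mult_pos_pos) auto
      moreover have "(\<rho> \<bullet> v) * (q \<bullet> v') \<ge> 0" using qv'[OF that] rv by simp
      ultimately show ?thesis by (simp add: p_def inner_add_left inner_diff_left)
    qed
    moreover have "p \<bullet> v = 0" by (simp add: p_def inner_add_left inner_diff_left)
    moreover have "p \<in> S" by (simp add: p_def subspace_add subspace_scale subspace_neg subspace_diff S \<rho> qS)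
    ultimately show ?thesis by blast
  qed
  show ?thesis
    by (rule that[of M]) (use M facet in \<open>auto simp: C_def\<close>)
qed

section \<open>Words in reflections and their action on chambers\<close>

definition refl_word :: "'a::euclidean_space list \<Rightarrow> 'a \<Rightarrow> 'a" where
  "refl_word as x = foldr hrefl as x"

lemma refl_word_simps [simp]: "refl_word [] x = x" "refl_word (a # as) x = hrefl a (refl_word as x)"
  "refl_word (as @ bs) x = refl_word as (refl_word bs x)"
  by (simp_all add: refl_word_def)

lemma refl_word_inner: "refl_word as x \<bullet> refl_word as y = x \<bullet> y"
  by (induction as) (simp_all add: hrefl_inner)

lemma refl_word_minus: "refl_word as (- x) = - refl_word as x"
  by (induction as) (simp_all add: hrefl_minus)

lemma hrefl_refl_word: "hrefl (refl_word as v) (refl_word as x) = refl_word as (hrefl v x)"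
  by (induction as) (simp_all add: hrefl_conj)

lemma refl_word_in:
  assumes "\<And>a b. a \<in> \<Phi> \<Longrightarrow> b \<in> \<Phi> \<Longrightarrow> hrefl a b \<in> \<Phi>" "set as \<subseteq> \<Phi>" "v \<in> \<Phi>"
  shows "refl_word as v \<in> \<Phi>"
  using assms(2) by (induction as) (use assms(1,3) in auto)

lemma small_perturbation:
  fixes p :: "'a::euclidean_space"
  assumes "finite M" "\<And>v. v \<in> M \<Longrightarrow> p \<bullet> v > 0"
  shows "\<exists>e>0. \<forall>v\<in>M. \<forall>t. 0 \<le> t \<and> t \<le> e \<longrightarrow> (p + t *\<^sub>R d) \<bullet> v > 0"
  using assms
proof (induction M rule: finite_induct)
  case empty
  then show ?case by (auto intro: exI[of _ 1])
next
  case (insert v M)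
  then obtain e where e: "e > 0" "\<forall>v\<in>M. \<forall>t. 0 \<le> t \<and> t \<le> e \<longrightarrow> (p + t *\<^sub>R d) \<bullet> v > 0" by auto
  \<comment> \<open>The \<open>+ 1\<close> keeps the denominator positive and the resulting
    inequality strict.\<close>
  define e' where "e' = (p \<bullet> v) / (\<bar>d \<bullet> v\<bar> + 1)"
  have pv: "p \<bullet> v > 0" using insert by auto
  have e': "e' > 0" using pv by (simp add: e'_def)
  have "(p + t *\<^sub>R d) \<bullet> v > 0" if "0 \<le> t" "t \<le> e'" for t
  proof -
    have "t * (\<bar>d \<bullet> v\<bar> + 1) \<le> p \<bullet> v" using that by (simp add: e'_def pos_le_divide_eq)
    moreover have "t * \<bar>d \<bullet> v\<bar> \<ge> - (t * (d \<bullet> v))"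
      using that by (metis abs_ge_minus_self abs_mult abs_of_nonneg)
    ultimately have "t = 0 \<or> p \<bullet> v + t * (d \<bullet> v) > 0" using that by (auto simp: algebra_simps)
    then show ?thesis using pv by (auto simp: inner_add_left)
  qed
  then show ?case using e e' by (intro exI[of _ "min e e'"]) auto
qed

text \<open>A finite root system normalized to unit vectors, neither crystallographic nor spanning.
  The vector \<open>\<rho>\<close> lies on no root hyperplane and thereby singles out a
  chamber.\<close>

locale root_set =
  fixes \<Phi> :: "'a::euclidean_space set" and \<rho> :: 'a
  assumes finite_roots: "finite \<Phi>"
    and norm_roots: "a \<in> \<Phi> \<Longrightarrow> norm a = 1"
    and refl_roots: "a \<in> \<Phi> \<Longrightarrow> b \<in> \<Phi> \<Longrightarrow> hrefl a b \<in> \<Phi>"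
    and regular: "a \<in> \<Phi> \<Longrightarrow> \<rho> \<bullet> a \<noteq> 0"
begin

definition pos :: "'a set" where "pos = {a \<in> \<Phi>. \<rho> \<bullet> a > 0}"
definition chamber :: "'a set" where "chamber = {y. \<forall>a\<in>pos. 0 \<le> y \<bullet> a}"

lemma uminus_root: "a \<in> \<Phi> \<Longrightarrow> - a \<in> \<Phi>"
  by (metis hrefl_self refl_roots)

lemma pos_cases: "a \<in> \<Phi> \<Longrightarrow> a \<in> pos \<or> - a \<in> pos"
  using regular[of a] uminus_root[of a] by (auto simp: pos_def)

lemma pos_neg: "a \<in> pos \<Longrightarrow> - a \<notin> pos"
  by (auto simp: pos_def)

text \<open>Encoded by the two facts that the arguments on words use: simple roots cut out the
  chamber, and a simple reflection keeps every other positive root positive.\<close>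

definition simple_system :: "'a set \<Rightarrow> bool" where
  "simple_system \<Delta> \<longleftrightarrow> \<Delta> \<subseteq> pos \<and> {y. \<forall>a\<in>\<Delta>. 0 \<le> y \<bullet> a} = chamber \<and>
     (\<forall>\<delta>\<in>\<Delta>. \<forall>v\<in>pos. v \<noteq> \<delta> \<longrightarrow> hrefl \<delta> v \<in> pos)"

text \<open>The facet normals of the chamber are simple. A point \<open>p\<close> inside the facet
  of \<open>\<delta>\<close> is orthogonal to no other positive root and is fixed by the reflection
  in \<open>\<delta>\<close>, so it still has positive inner product with the reflected
  root.\<close>

lemma simple_system_exists: "\<exists>\<Delta>. simple_system \<Delta>"
proof -
  have fin: "finite pos" using finite_roots by (simp add: pos_def)
  obtain \<Delta> where D: "\<Delta> \<subseteq> pos"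
    and eq: "{u \<in> UNIV. \<forall>v\<in>\<Delta>. 0 \<le> u \<bullet> v} = {u \<in> UNIV. \<forall>v\<in>pos. 0 \<le> u \<bullet> v}"
    and fac: "\<And>v. v \<in> \<Delta> \<Longrightarrow> \<exists>p\<in>UNIV. p \<bullet> v = 0 \<and> (\<forall>v'\<in>\<Delta> - {v}. p \<bullet> v' > 0)"
    using facet_points[OF subspace_UNIV fin, of \<rho>] by (auto simp: pos_def)
  have "hrefl \<delta> v \<in> pos" if d: "\<delta> \<in> \<Delta>" and v: "v \<in> pos" "v \<noteq> \<delta>" for \<delta> v
  proof -
    obtain p where p: "p \<bullet> \<delta> = 0" "\<And>v'. v' \<in> \<Delta> - {\<delta>} \<Longrightarrow> p \<bullet> v' > 0" using fac d by blast
    then have pC: "p \<in> chamber" using eq by (force simp: chamber_def)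
    have n1: "\<delta> \<bullet> \<delta> = 1" "v \<bullet> v = 1"
      using norm_roots d D v by (auto simp: pos_def dot_square_norm)
    have "p \<bullet> v \<noteq> 0"
    proof
      assume pv: "p \<bullet> v = 0"
      \<comment> \<open>The negative of the part of \<open>v\<close> orthogonal to
        \<open>\<delta>\<close>. Moving \<open>p\<close> along \<open>w\<close> stays in the chamber
        but decreases the inner product with \<open>v\<close> unless \<open>w = 0\<close>, that is,
        unless \<open>v\<close> is parallel to \<open>\<delta>\<close>.\<close>
      define w where "w = (v \<bullet> \<delta>) *\<^sub>R \<delta> - v"
      have wd: "w \<bullet> \<delta> = 0" by (simp add: w_def inner_diff_left n1)
      obtain e where e: "e > 0" "\<forall>v\<in>\<Delta> - {\<delta>}. \<forall>t. 0 \<le> t \<and> t \<le> e \<longrightarrow> (p + t *\<^sub>R w) \<bullet> v > 0"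
        using small_perturbation[of "\<Delta> - {\<delta>}" p w] p fin D finite_subset by blast
      have "0 \<le> (p + e *\<^sub>R w) \<bullet> a" if "a \<in> \<Delta>" for a
      proof (cases "a = \<delta>")
        case False
        then show ?thesis using e that by (auto intro!: less_imp_le)
      qed (simp add: inner_add_left p wd)
      then have "p + e *\<^sub>R w \<in> chamber" using eq by (auto simp: chamber_def)
      then have "0 \<le> e * (w \<bullet> v)" using v pv by (auto simp: chamber_def inner_add_left)
      then have "w \<bullet> v \<ge> 0" using e by (simp add: zero_le_mult_iff)
      moreover have "w \<bullet> w = - (w \<bullet> v)"
        using wd by (simp add: w_def inner_diff_right)
      ultimately have "w \<bullet> w = 0" using inner_ge_zero[of w] by linarith
      then have "w = 0" by simp
      then have veq: "v = (v \<bullet> \<delta>) *\<^sub>R \<delta>" by (simp add: w_def)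
      then have "norm v = \<bar>v \<bullet> \<delta>\<bar> * norm \<delta>" by (metis norm_scaleR)
      then have "v \<bullet> \<delta> = 1 \<or> v \<bullet> \<delta> = -1" using n1 by (auto simp: norm_eq_sqrt_inner abs_if split: if_splits)
      then have "v = \<delta> \<or> v = - \<delta>" using veq by (metis scaleR_minus1_left scaleR_one)
      then show False using v d D pos_neg by auto
    qed
    then have "p \<bullet> v > 0" using pC v by (force simp: chamber_def)
    moreover have "p \<bullet> hrefl \<delta> v = p \<bullet> v"
      by (metis hrefl_fixes hrefl_inner_swap p(1))
    ultimately have "- hrefl \<delta> v \<notin> pos" using pC by (force simp: chamber_def)
    then show ?thesis using pos_cases refl_roots d v D by (auto simp: pos_def)
  qed
  then show ?thesis using D eq unfolding simple_system_def by (intro exI[of _ \<Delta>]) (auto simp: chamber_def)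
qed

text \<open>The deletion property. When the letters act on \<open>\<delta>\<close> one after the
  other, some letter \<open>a\<close> first turns a positive root negative. That root must be
  \<open>a\<close> itself, so conjugation cancels \<open>a\<close> against the reflection in
  \<open>\<delta>\<close>.\<close>

lemma simple_deletion:
  assumes D: "simple_system \<Delta>" and "\<delta> \<in> \<Delta>"
  shows "set as \<subseteq> \<Delta> \<Longrightarrow> refl_word as \<delta> \<notin> pos \<Longrightarrow>
    \<exists>bs. set bs \<subseteq> \<Delta> \<and> Suc (length bs) = length as \<and> (\<forall>x. refl_word as (hrefl \<delta> x) = refl_word bs x)"
proof (induction as)
  case Nil
  then show ?case using assms by (auto simp: simple_system_def)
next
  case (Cons a as)
  show ?case
  proof (cases "refl_word as \<delta> \<in> pos")
    case False
    then obtain bs where "set bs \<subseteq> \<Delta>" "Suc (length bs) = length as"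
      "\<forall>x. refl_word as (hrefl \<delta> x) = refl_word bs x" using Cons by auto
    then show ?thesis using Cons.prems by (intro exI[of _ "a # bs"]) auto
  next
    case True
    then have "refl_word as \<delta> = a" using D Cons.prems unfolding simple_system_def by auto
    then have "hrefl a (refl_word as (hrefl \<delta> x)) = refl_word as x" for x
      by (metis hrefl_hrefl hrefl_refl_word)
    then show ?thesis using Cons.prems by (intro exI[of _ as]) auto
  qed
qed

text \<open>Induction on the height \<open>\<rho> \<bullet> v\<close>, measured by counting lower
  positive roots. A positive root makes an acute angle with some simple root, as otherwise
  \<open>- v\<close> would lie in the chamber. If \<open>v\<close> is not simple, reflecting in that
  simple root lowers the height.\<close>

lemma hrefl_pos_simple_word:
  assumes D: "simple_system \<Delta>" and "v \<in> pos"
  shows "\<exists>as. set as \<subseteq> \<Delta> \<and> (\<forall>x. hrefl v x = refl_word as x)"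
  using assms(2)
proof (induction "card {a \<in> pos. \<rho> \<bullet> a < \<rho> \<bullet> v}" arbitrary: v rule: less_induct)
  case less
  note v = less.prems
  have Dp: "\<Delta> \<subseteq> pos" using D by (simp add: simple_system_def)
  show ?case
  proof (cases "v \<in> \<Delta>")
    case True
    then show ?thesis by (intro exI[of _ "[v]"]) auto
  next
    case False
    have "v \<noteq> 0" using v regular by (auto simp: pos_def)
    have "\<exists>\<delta>\<in>\<Delta>. v \<bullet> \<delta> > 0"
    proof (rule ccontr)
      assume "\<not> ?thesis"
      then have "\<forall>\<delta>\<in>\<Delta>. 0 \<le> (- v) \<bullet> \<delta>" by (auto simp: not_less)
      then have "- v \<in> chamber" using D unfolding simple_system_def by blast
      then have "0 \<le> (- v) \<bullet> v" using v by (simp add: chamber_def)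
      then have "v \<bullet> v \<le> 0" by simp
      then show False using \<open>v \<noteq> 0\<close> by (meson inner_gt_zero_iff not_le)
    qed
    then obtain \<delta> where d: "\<delta> \<in> \<Delta>" "v \<bullet> \<delta> > 0" by blast
    then have u: "hrefl \<delta> v \<in> pos" using D v False unfolding simple_system_def by auto
    have nd: "\<delta> \<bullet> \<delta> = 1" "\<rho> \<bullet> \<delta> > 0" using d Dp norm_roots by (auto simp: pos_def dot_square_norm)
    have lt: "\<rho> \<bullet> hrefl \<delta> v < \<rho> \<bullet> v"
      using d nd by (simp add: hrefl_def inner_diff_right)
    have "finite pos" using finite_roots by (simp add: pos_def)
    then have "card {a \<in> pos. \<rho> \<bullet> a < \<rho> \<bullet> hrefl \<delta> v} < card {a \<in> pos. \<rho> \<bullet> a < \<rho> \<bullet> v}"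
      using lt u by (intro psubset_card_mono) auto
    then obtain as where as: "set as \<subseteq> \<Delta>" "\<forall>x. hrefl (hrefl \<delta> v) x = refl_word as x"
      using less.hyps u by blast
    have "hrefl v x = refl_word (\<delta> # as @ [\<delta>]) x" for x
      using as(2) hrefl_conj[of \<delta> v "hrefl \<delta> x"] by (metis hrefl_hrefl refl_word_simps)
    then show ?thesis using as d by (intro exI[of _ "\<delta> # as @ [\<delta>]"]) auto
  qed
qed

lemma word_simple_word:
  assumes D: "simple_system \<Delta>" and "set as \<subseteq> \<Phi>"
  shows "\<exists>bs. set bs \<subseteq> \<Delta> \<and> (\<forall>x. refl_word as x = refl_word bs x)"
  using assms(2)
proof (induction as)
  case Nil
  then show ?case by (intro exI[of _ "[]"]) auto
next
  case (Cons a as)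
  then obtain bs where bs: "set bs \<subseteq> \<Delta>" "\<forall>x. refl_word as x = refl_word bs x" by auto
  obtain cs where cs: "set cs \<subseteq> \<Delta>" "\<forall>x. hrefl a x = refl_word cs x"
    using pos_cases[of a] hrefl_pos_simple_word[OF D, of a] hrefl_pos_simple_word[OF D, of "- a"] Cons
    by auto
  show ?case using bs cs by (intro exI[of _ "cs @ bs"]) auto
qed

lemma simple_word_chamber:
  assumes D: "simple_system \<Delta>"
  shows "set as \<subseteq> \<Delta> \<Longrightarrow> y \<in> chamber \<Longrightarrow> refl_word as y \<in> chamber \<Longrightarrow> refl_word as y = y"
proof (induction "length as" arbitrary: as rule: less_induct)
  case less
  show ?case
  proof (cases as rule: rev_cases)
    case (snoc bs \<delta>)
    have Dp: "\<Delta> \<subseteq> pos" and d: "\<delta> \<in> \<Delta>" "set bs \<subseteq> \<Delta>"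
      using D less.prems snoc by (auto simp: simple_system_def)
    show ?thesis
    proof (cases "refl_word as \<delta> \<in> pos")
      case False
      have "refl_word as \<delta> \<in> \<Phi>"
        by (rule refl_word_in[of \<Phi>]) (use refl_roots less.prems Dp d in \<open>auto simp: pos_def\<close>)
      then have "- refl_word as \<delta> \<in> pos" using pos_cases False by blast
      then have "0 \<le> refl_word as y \<bullet> (- refl_word as \<delta>)" using less.prems by (auto simp: chamber_def)
      then have "y \<bullet> \<delta> \<le> 0" by (simp add: refl_word_inner)
      moreover have "y \<bullet> \<delta> \<ge> 0" using less.prems d Dp by (auto simp: chamber_def)
      ultimately have "hrefl \<delta> y = y" by (simp add: hrefl_fixes)
      then have "refl_word as y = refl_word bs y" by (simp add: snoc)
      then show ?thesis using less.hyps[of bs] less.prems d snoc by auto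
    next
      case True
      then have "- refl_word bs \<delta> \<in> pos" by (simp add: snoc hrefl_self refl_word_minus)
      then have "refl_word bs \<delta> \<notin> pos" using pos_neg by blast
      then obtain cs where cs: "set cs \<subseteq> \<Delta>" "Suc (length cs) = length bs" "\<forall>x. refl_word bs (hrefl \<delta> x) = refl_word cs x"
        using simple_deletion[OF D d(1) d(2)] by blast
      then have "refl_word as y = refl_word cs y" by (simp add: snoc)
      then show ?thesis using less.hyps[of cs] less.prems cs snoc by auto
    qed
  qed auto
qed

lemma chamber_unique:
  assumes "set as \<subseteq> \<Phi>" "y \<in> chamber" "refl_word as y \<in> chamber"
  shows "refl_word as y = y"
  using simple_system_exists word_simple_word simple_word_chamber assms by metis

end

text \<open>Finitely many hyperplanes form a null set and cannot cover the space.\<close>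

lemma exists_regular_vector:
  assumes "finite (\<Phi> :: 'a::euclidean_space set)" "0 \<notin> \<Phi>"
  shows "\<exists>\<rho>. \<forall>a\<in>\<Phi>. \<rho> \<bullet> a \<noteq> 0"
proof (rule ccontr)
  assume "\<not> ?thesis"
  then have "UNIV \<subseteq> (\<Union>a\<in>\<Phi>. {x. a \<bullet> x = 0})" by (auto simp: inner_commute)
  moreover have "negligible (\<Union>a\<in>\<Phi>. {x. a \<bullet> x = 0})"
    using assms by (intro negligible_Union) (auto intro!: negligible_hyperplane)
  ultimately show False using negligible_subset by (metis non_negligible_UNIV)
qed

subsection \<open>Orbits of compact isometry groups\<close>

definition blinfun_power :: "('a::real_normed_vector \<Rightarrow>\<^sub>L 'a) \<Rightarrow> nat \<Rightarrow> ('a \<Rightarrow>\<^sub>L 'a)" where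
  "blinfun_power h n = ((o\<^sub>L) h ^^ n) id_blinfun"

lemma blinfun_power_simps [simp]:
  "blinfun_power h 0 = id_blinfun" "blinfun_power h (Suc n) = h o\<^sub>L blinfun_power h n"
  by (simp_all add: blinfun_power_def)

lemma norm_blinfun_power_diff:
  assumes "norm h \<le> 1"
  shows "norm (blinfun_power h n - id_blinfun) \<le> real n * norm (h - id_blinfun)"
proof (induction n)
  case (Suc n)
  have "blinfun_power h (Suc n) - id_blinfun = (h o\<^sub>L (blinfun_power h n - id_blinfun)) + (h - id_blinfun)"
    by (rule blinfun_eqI) (simp add: blinfun.bilinear_simps)
  then have "norm (blinfun_power h (Suc n) - id_blinfun)
      \<le> norm (h o\<^sub>L (blinfun_power h n - id_blinfun)) + norm (h - id_blinfun)"
    by (metis norm_triangle_ineq)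
  also have "\<dots> \<le> norm h * norm (blinfun_power h n - id_blinfun) + norm (h - id_blinfun)"
    by (simp add: norm_blinfun_compose)
  also have "\<dots> \<le> norm (blinfun_power h n - id_blinfun) + norm (h - id_blinfun)"
    using assms by (simp add: mult_left_le_one_le)
  finally show ?case using Suc by (simp add: algebra_simps)
qed simp

text \<open>Powers of an element near the identity follow its tangent direction up to second order.
  This takes the place of the exponential map.\<close>

lemma norm_blinfun_power_linearization:
  assumes "norm h \<le> 1"
  shows "norm (blinfun_power h n - id_blinfun - real n *\<^sub>R (h - id_blinfun)) \<le> (real n * norm (h - id_blinfun))\<^sup>2"
proof (induction n)
  case (Suc n)
  let ?d = "norm (h - id_blinfun)"
  have "blinfun_power h (Suc n) - id_blinfun - real (Suc n) *\<^sub>R (h - id_blinfun) =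
     ((h - id_blinfun) o\<^sub>L (blinfun_power h n - id_blinfun)) + (blinfun_power h n - id_blinfun - real n *\<^sub>R (h - id_blinfun))"
    by (rule blinfun_eqI) (simp add: blinfun.bilinear_simps algebra_simps)
  then have "norm (blinfun_power h (Suc n) - id_blinfun - real (Suc n) *\<^sub>R (h - id_blinfun)) \<le>
     norm ((h - id_blinfun) o\<^sub>L (blinfun_power h n - id_blinfun)) + norm (blinfun_power h n - id_blinfun - real n *\<^sub>R (h - id_blinfun))"
    by (metis norm_triangle_ineq)
  also have "\<dots> \<le> ?d * (n * ?d) + (n * ?d)\<^sup>2"
    using Suc norm_blinfun_compose[of "h - id_blinfun" "blinfun_power h n - id_blinfun"]
      mult_left_mono[OF norm_blinfun_power_diff[OF assms, of n], of ?d]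
    by (smt (verit) norm_ge_zero)
  also have "\<dots> \<le> (Suc n * ?d)\<^sup>2"
    by (simp add: power2_eq_square algebra_simps)
  finally show ?case .
qed simp

lemma norm_blinfun_power_move:
  fixes h :: "'a::real_normed_vector \<Rightarrow>\<^sub>L 'a"
  assumes "\<And>x. norm (h x) = norm x"
  shows "norm (blinfun_power h n y - y) \<le> real n * norm (h y - y)"
proof (induction n)
  case (Suc n)
  have "h (blinfun_power h n y) - y = h (blinfun_power h n y - y) + (h y - y)"
    by (simp add: blinfun.diff_right)
  then have "norm (h (blinfun_power h n y) - y) \<le> norm (h (blinfun_power h n y - y)) + norm (h y - y)"
    using norm_triangle_ineq by metis
  then show ?case using Suc assms by (simp add: algebra_simps)
qed simp

text \<open>Bounded linear functions serve as elements so that the operator norm measures the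
  distance from the identity.\<close>

locale compact_isometry_group =
  fixes H :: "('a::euclidean_space \<Rightarrow>\<^sub>L 'a) set"
  assumes compact_H: "compact H"
    and id_H: "id_blinfun \<in> H"
    and compose_H: "h \<in> H \<Longrightarrow> k \<in> H \<Longrightarrow> h o\<^sub>L k \<in> H"
    and inverse_H: "h \<in> H \<Longrightarrow> \<exists>k\<in>H. h o\<^sub>L k = id_blinfun \<and> k o\<^sub>L h = id_blinfun"
    and isometry_H: "h \<in> H \<Longrightarrow> norm (h x) = norm x"
begin

lemma norm_H: "h \<in> H \<Longrightarrow> norm h \<le> 1"
  by (rule norm_blinfun_bound) (simp_all add: isometry_H)

lemma power_H: "h \<in> H \<Longrightarrow> blinfun_power h n \<in> H"
  by (induction n) (simp_all add: id_H compose_H)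

text \<open>Take \<open>k\<close> to be \<open>h\<close> after the inverse of \<open>u\<close>. The
  inverse also fixes \<open>y\<close>, and composing with it does not increase the norm of
  \<open>h - u\<close>.\<close>

lemma norm_compose_inverse:
  assumes "h \<in> H" "u \<in> H"  "blinfun_apply u y = y"
  obtains k where "k \<in> H" "blinfun_apply k y = blinfun_apply h y" "norm (k - id_blinfun) \<le> norm (h - u)"
proof -
  obtain v where v: "v \<in> H" "u o\<^sub>L v = id_blinfun" "v o\<^sub>L u = id_blinfun"
    using inverse_H assms by blast
  have "blinfun_apply v y = y" using v assms by (metis blinfun_apply_blinfun_compose blinfun_apply_id_blinfun)
  have "(h o\<^sub>L v) - id_blinfun = (h - u) o\<^sub>L v"
    using v by (metis (no_types, lifting) blinfun_apply_blinfun_compose blinfun_eqI minus_blinfun.rep_eq)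
  then have "norm ((h o\<^sub>L v) - id_blinfun) \<le> norm (h - u) * norm v"
    by (metis norm_blinfun_compose)
  also have "\<dots> \<le> norm (h - u)" using norm_H[OF v(1)] by (simp add: mult_left_le)
  finally show thesis
    using that[of "h o\<^sub>L v"] compose_H assms v \<open>blinfun_apply v y = y\<close> by simp
qed

text \<open>Raise \<open>h n\<close> to the power at which its distance from the identity has
  accumulated to about \<open>\<epsilon>\<close>. A limit of these powers is within second order of
  the identity plus \<open>\<epsilon> *\<^sub>R X\<close>. It fixes \<open>y\<close>, since the
  accumulated displacement of \<open>y\<close> is at most \<open>\<epsilon>\<close> times a ratio
  tending to zero.\<close>

lemma tangent_element:
  fixes h :: "nat \<Rightarrow> 'a \<Rightarrow>\<^sub>L 'a"
  assumes h: "\<And>n. h n \<in> H" and e0: "\<And>n. norm (h n - id_blinfun) > 0"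
    and lim: "(\<lambda>n. norm (h n - id_blinfun)) \<longlonglongrightarrow> 0"
    and slow: "(\<lambda>n. norm (blinfun_apply (h n) y - y) / norm (h n - id_blinfun)) \<longlonglongrightarrow> 0"
    and X: "(\<lambda>n. (h n - id_blinfun) /\<^sub>R norm (h n - id_blinfun)) \<longlonglongrightarrow> X"
    and "\<epsilon> > 0"
  shows "\<exists>E\<in>H. blinfun_apply E y = y \<and> norm (E - id_blinfun - \<epsilon> *\<^sub>R X) \<le> \<epsilon>\<^sup>2"
proof -
  define d where "d n = norm (h n - id_blinfun)" for n
  \<comment> \<open>The number of steps of length \<open>d n\<close> that fit into
    \<open>\<epsilon>\<close>, so that \<open>m n * d n\<close> lies between
    \<open>\<epsilon> - d n\<close> and \<open>\<epsilon>\<close>.\<close>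
  define m where "m n = nat \<lfloor>\<epsilon> / d n\<rfloor>" for n
  define P where "P n = blinfun_power (h n) (m n)" for n
  have d0: "d n > 0" for n using e0 by (simp add: d_def)
  have mle: "real (m n) * d n \<le> \<epsilon>" for n
  proof -
    have "real (m n) \<le> \<epsilon> / d n" using \<open>\<epsilon> > 0\<close> d0[of n] by (simp add: m_def)
    then show ?thesis using d0[of n] by (simp add: pos_le_divide_eq)
  qed
  have mge: "real (m n) * d n \<ge> \<epsilon> - d n" for n
  proof -
    have "\<epsilon> / d n \<ge> 0" using \<open>\<epsilon> > 0\<close> d0[of n] by simp
    then have "real (m n) = of_int \<lfloor>\<epsilon> / d n\<rfloor>" by (simp add: m_def)
    then have "real (m n) \<ge> \<epsilon> / d n - 1" by linarith
    then have "real (m n) * d n \<ge> (\<epsilon> / d n - 1) * d n" using d0[of n] by (intro mult_right_mono) auto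
    then show ?thesis using d0[of n] by (simp add: left_diff_distrib)
  qed
  have "(\<lambda>n. real (m n) * d n) \<longlonglongrightarrow> \<epsilon>"
  proof (rule tendsto_sandwich[of "\<lambda>n. \<epsilon> - d n" _ _ "\<lambda>_. \<epsilon>"])
    show "(\<lambda>n. \<epsilon> - d n) \<longlonglongrightarrow> \<epsilon>" using tendsto_diff[OF tendsto_const lim, of \<epsilon>] by (simp add: d_def)
  qed (use mle mge in auto)
  from tendsto_scaleR[OF this X]
  have lin: "(\<lambda>n. real (m n) *\<^sub>R (h n - id_blinfun)) \<longlonglongrightarrow> \<epsilon> *\<^sub>R X"
  proof (rule Lim_transform_eventually)
    have "(real (m n) * d n) *\<^sub>R ((h n - id_blinfun) /\<^sub>R norm (h n - id_blinfun)) = real (m n) *\<^sub>R (h n - id_blinfun)" for n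
      using d0[of n] by (simp add: d_def field_simps)
    then show "\<forall>\<^sub>F n in sequentially. (real (m n) * d n) *\<^sub>R ((h n - id_blinfun) /\<^sub>R norm (h n - id_blinfun)) = real (m n) *\<^sub>R (h n - id_blinfun)"
      by simp
  qed
  have "\<forall>n. P n \<in> H" using power_H h by (simp add: P_def)
  then obtain E r where E: "E \<in> H" "strict_mono r" "(P \<circ> r) \<longlonglongrightarrow> E"
    using compact_H unfolding compact_def by metis
  have lin': "(\<lambda>n. real (m (r n)) *\<^sub>R (h (r n) - id_blinfun)) \<longlonglongrightarrow> \<epsilon> *\<^sub>R X"
    using LIMSEQ_subseq_LIMSEQ[OF lin E(2)] by (simp add: o_def)
  have E': "(\<lambda>n. P (r n)) \<longlonglongrightarrow> E" using E(3) by (simp add: o_def)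
  have "norm (E - id_blinfun - \<epsilon> *\<^sub>R X) \<le> \<epsilon>\<^sup>2"
  proof (rule tendsto_upperbound)
    show "(\<lambda>n. norm (P (r n) - id_blinfun - real (m (r n)) *\<^sub>R (h (r n) - id_blinfun))) \<longlonglongrightarrow> norm (E - id_blinfun - \<epsilon> *\<^sub>R X)"
      by (rule tendsto_norm[OF tendsto_diff[OF tendsto_diff[OF E' tendsto_const] lin']])
    have "norm (P n - id_blinfun - real (m n) *\<^sub>R (h n - id_blinfun)) \<le> \<epsilon>\<^sup>2" for n
    proof -
      have "norm (P n - id_blinfun - real (m n) *\<^sub>R (h n - id_blinfun)) \<le> (real (m n) * d n)\<^sup>2"
        unfolding P_def d_def by (intro norm_blinfun_power_linearization norm_H h)
      also have "\<dots> \<le> \<epsilon>\<^sup>2" using mle[of n] d0[of n] by (intro power_mono) auto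
      finally show ?thesis .
    qed
    then show "\<forall>\<^sub>F n in sequentially. norm (P (r n) - id_blinfun - real (m (r n)) *\<^sub>R (h (r n) - id_blinfun)) \<le> \<epsilon>\<^sup>2"
      by simp
  qed simp
  moreover have "blinfun_apply E y = y"
  proof -
    have "norm (blinfun_apply (P n) y - y) \<le> \<epsilon> * (norm (blinfun_apply (h n) y - y) / d n)" for n
    proof -
      have "norm (blinfun_apply (P n) y - y) \<le> real (m n) * norm (blinfun_apply (h n) y - y)"
        unfolding P_def by (intro norm_blinfun_power_move isometry_H h)
      also have "real (m n) \<le> \<epsilon> / d n" using mle[of n] d0[of n] by (simp add: pos_le_divide_eq)
      finally show ?thesis by (simp add: mult_right_mono)
    qed
    then have b: "norm (blinfun_apply (P (r n)) y - y) \<le> \<epsilon> * (norm (blinfun_apply (h (r n)) y - y) / d (r n))" for n by simp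
    have "(\<lambda>n. norm (blinfun_apply (h (r n)) y - y) / d (r n)) \<longlonglongrightarrow> 0"
      using LIMSEQ_subseq_LIMSEQ[OF slow E(2)] by (simp add: o_def d_def)
    from tendsto_mult_right_zero[OF this, of \<epsilon>]
    have "(\<lambda>n. blinfun_apply (P (r n)) y - y) \<longlonglongrightarrow> 0"
      by (rule Lim_null_comparison[rotated]) (use b in simp)
    moreover have "(\<lambda>n. blinfun_apply (P (r n)) y - y) \<longlonglongrightarrow> blinfun_apply E y - y"
      by (rule tendsto_diff[OF blinfun.tendsto[OF E' tendsto_const] tendsto_const])
    ultimately show ?thesis using LIMSEQ_unique by fastforce
  qed
  ultimately show ?thesis using E by blast
qed

text \<open>Among the elements with a given value at \<open>y\<close> take one closest to the identity. If it were much
  farther from the identity than it moves \<open>y\<close>, a limit of powers of such elements would fix \<open>y\<close>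
  and could be used to bring it closer.\<close>

lemma orbit_lift_Lipschitz:
  "\<exists>C\<ge>0. \<forall>h\<in>H. \<exists>k\<in>H. blinfun_apply k y = blinfun_apply h y \<and> norm (k - id_blinfun) \<le> C * norm (blinfun_apply h y - y)"
proof (rule ccontr)
  assume neg: "\<not> ?thesis"
  have "\<exists>h\<in>H. (\<forall>k\<in>H. blinfun_apply k y = blinfun_apply h y \<longrightarrow> norm (h - id_blinfun) \<le> norm (k - id_blinfun)) \<and>
     norm (h - id_blinfun) > real n * norm (blinfun_apply h y - y)" for n :: nat
  proof -
    obtain h where h: "h \<in> H" "\<And>k. k \<in> H \<Longrightarrow> blinfun_apply k y = blinfun_apply h y \<Longrightarrow> \<not> norm (k - id_blinfun) \<le> real n * norm (blinfun_apply h y - y)"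
      using neg by (meson of_nat_0_le_iff)
    have "closed {k. blinfun_apply k y = blinfun_apply h y}"
      by (intro closed_Collect_eq continuous_intros)
    then have "compact (H \<inter> {k. blinfun_apply k y = blinfun_apply h y})" using compact_H by (rule compact_Int_closed[rotated])
    moreover have "continuous_on (H \<inter> {k. blinfun_apply k y = blinfun_apply h y}) (\<lambda>k. norm (k - id_blinfun))"
      by (intro continuous_intros)
    ultimately obtain k where "k \<in> H \<inter> {k. blinfun_apply k y = blinfun_apply h y}"
      "\<forall>l\<in>H \<inter> {k. blinfun_apply k y = blinfun_apply h y}. norm (k - id_blinfun) \<le> norm (l - id_blinfun)"
      using continuous_attains_inf[of "H \<inter> {k. blinfun_apply k y = blinfun_apply h y}" "\<lambda>k. norm (k - id_blinfun)"] h by blast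
    then show ?thesis using h by (intro bexI[of _ k]) (auto simp: not_le)
  qed
  then obtain g where g: "\<And>n. g n \<in> H"
    and gmin: "\<And>n k. k \<in> H \<Longrightarrow> blinfun_apply k y = blinfun_apply (g n) y \<Longrightarrow> norm (g n - id_blinfun) \<le> norm (k - id_blinfun)"
    and gbig: "\<And>n. norm (g n - id_blinfun) > real n * norm (blinfun_apply (g n) y - y)"
    by metis
  obtain u r where u: "u \<in> H" "strict_mono r" "(g \<circ> r) \<longlonglongrightarrow> u"
    using compact_H g unfolding compact_def by metis
  have g0: "norm (g n - id_blinfun) > 0" for n
    using gbig[of n] by (smt (verit) mult_nonneg_nonneg norm_ge_zero of_nat_0_le_iff)
  have slow0: "norm (blinfun_apply (g n) y - y) / norm (g n - id_blinfun) \<le> 1 / real n" if "n > 0" for n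
    using gbig[of n] g0[of n] that by (simp add: field_simps)
  have slow: "(\<lambda>n. norm (blinfun_apply (g n) y - y) / norm (g n - id_blinfun)) \<longlonglongrightarrow> 0"
  proof (rule tendsto_sandwich[of "\<lambda>_. 0" _ _ "\<lambda>n. 1 / real n"])
    show "\<forall>\<^sub>F n in sequentially. norm (blinfun_apply (g n) y - y) / norm (g n - id_blinfun) \<le> 1 / real n"
      using slow0 eventually_gt_at_top[of 0] by (rule eventually_mono[rotated])
  qed (auto intro: lim_1_over_n)
  have "blinfun_apply u y = y"
  proof -
    have "norm (blinfun_apply (g n) y - y) \<le> 2 * (norm (blinfun_apply (g n) y - y) / norm (g n - id_blinfun))" for n
    proof -
      have "norm (g n - id_blinfun) \<le> 2"
        using norm_triangle_ineq4[of "g n" id_blinfun] norm_H[OF g] norm_H[OF id_H] by (smt (verit))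
      then have "norm (blinfun_apply (g n) y - y) * norm (g n - id_blinfun) \<le> norm (blinfun_apply (g n) y - y) * 2"
        by (intro mult_left_mono) auto
      then show ?thesis using g0[of n] by (simp add: pos_le_divide_eq mult.commute)
    qed
    then have "(\<lambda>n. blinfun_apply (g n) y - y) \<longlonglongrightarrow> 0"
      by (intro Lim_null_comparison[OF _ tendsto_mult_right_zero[OF slow, of 2]]) simp
    from LIMSEQ_subseq_LIMSEQ[OF this u(2)] have "(\<lambda>n. blinfun_apply ((g \<circ> r) n) y - y) \<longlonglongrightarrow> 0" by (simp add: o_def)
    moreover have "(\<lambda>n. blinfun_apply ((g \<circ> r) n) y - y) \<longlonglongrightarrow> blinfun_apply u y - y"
      by (rule tendsto_diff[OF blinfun.tendsto[OF u(3) tendsto_const] tendsto_const])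
    ultimately show ?thesis using LIMSEQ_unique by fastforce
  qed
  \<comment> \<open>As \<open>u\<close> fixes \<open>y\<close>, composing \<open>g n\<close> with
    its inverse leaves the value at \<open>y\<close> unchanged, and minimality bounds the distance
    of \<open>g n\<close> from the identity by its distance from \<open>u\<close>.\<close>
  have lim1: "(\<lambda>n. norm ((g \<circ> r) n - id_blinfun)) \<longlonglongrightarrow> 0"
  proof (rule Lim_null_comparison)
    have "norm (g n - id_blinfun) \<le> norm (g n - u)" for n
      using norm_compose_inverse[OF g u(1) \<open>blinfun_apply u y = y\<close>, of n] gmin order_trans by metis
    then show "\<forall>\<^sub>F n in sequentially. norm (norm ((g \<circ> r) n - id_blinfun)) \<le> norm ((g \<circ> r) n - u)" by simp
    show "(\<lambda>n. norm ((g \<circ> r) n - u)) \<longlonglongrightarrow> 0"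
      by (rule tendsto_norm_zero[OF LIM_zero[OF u(3)]])
  qed
  define X where "X n = ((g \<circ> r) n - id_blinfun) /\<^sub>R norm ((g \<circ> r) n - id_blinfun)" for n
  have "\<forall>n. X n \<in> cball 0 1" using g0 by (simp add: X_def)
  moreover have "compact (cball (0 :: 'a \<Rightarrow>\<^sub>L 'a) 1)" by (rule compact_cball)
  ultimately obtain Y q where Y: "strict_mono q" "(X \<circ> q) \<longlonglongrightarrow> Y"
    unfolding compact_def by metis
  define h where "h n = g (r (q n))" for n
  have lim2: "(\<lambda>n. norm (h n - id_blinfun)) \<longlonglongrightarrow> 0"
    using LIMSEQ_subseq_LIMSEQ[OF lim1 Y(1)] by (simp add: h_def o_def)
  have slow2: "(\<lambda>n. norm (blinfun_apply (h n) y - y) / norm (h n - id_blinfun)) \<longlonglongrightarrow> 0"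
    using LIMSEQ_subseq_LIMSEQ[OF LIMSEQ_subseq_LIMSEQ[OF slow u(2)] Y(1)] by (simp add: h_def o_def)
  have X2: "(\<lambda>n. (h n - id_blinfun) /\<^sub>R norm (h n - id_blinfun)) \<longlonglongrightarrow> Y"
    using Y(2) by (simp add: h_def o_def X_def)
  \<comment> \<open>For large \<open>n\<close> the element \<open>h n\<close> and the element
    \<open>E\<close> built for its step length nearly agree, so \<open>h n\<close> is closer to
    \<open>E\<close> than to the identity. Composing with the inverse of \<open>E\<close> then
    contradicts minimality.\<close>
  have "(\<lambda>n. norm ((h n - id_blinfun) /\<^sub>R norm (h n - id_blinfun) - Y) + norm (h n - id_blinfun)) \<longlonglongrightarrow> 0 + 0"
    by (rule tendsto_add[OF tendsto_norm_zero[OF LIM_zero[OF X2]] lim2])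
  then have "\<forall>\<^sub>F n in sequentially. norm ((h n - id_blinfun) /\<^sub>R norm (h n - id_blinfun) - Y) + norm (h n - id_blinfun) < 1"
    by (intro order_tendstoD(2)) auto
  then obtain n where n: "norm ((h n - id_blinfun) /\<^sub>R norm (h n - id_blinfun) - Y) + norm (h n - id_blinfun) < 1"
    using eventually_happens'[OF sequentially_bot] by blast
  let ?e = "norm (h n - id_blinfun)"
  have e0: "?e > 0" using g0 by (simp add: h_def)
  obtain E where E: "E \<in> H" "blinfun_apply E y = y" "norm (E - id_blinfun - ?e *\<^sub>R Y) \<le> ?e\<^sup>2"
    using tangent_element[of h y Y ?e] lim2 slow2 X2 g g0 e0 by (auto simp: h_def)
  have "h n - E = (h n - id_blinfun - ?e *\<^sub>R Y) - (E - id_blinfun - ?e *\<^sub>R Y)" by simp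
  then have "norm (h n - E) \<le> norm (h n - id_blinfun - ?e *\<^sub>R Y) + norm (E - id_blinfun - ?e *\<^sub>R Y)"
    using norm_triangle_ineq4 by metis
  also have "h n - id_blinfun - ?e *\<^sub>R Y = ?e *\<^sub>R ((h n - id_blinfun) /\<^sub>R ?e - Y)"
    using e0 by (simp add: scaleR_diff_right)
  also have "norm \<dots> + norm (E - id_blinfun - ?e *\<^sub>R Y) \<le> ?e * (norm ((h n - id_blinfun) /\<^sub>R ?e - Y) + ?e)"
    using E by (simp add: distrib_left power2_eq_square)
  also have "\<dots> < ?e" using n e0 by (simp add: mult_less_cancel_left2)
  finally have "norm (h n - E) < ?e" .
  moreover obtain k where "k \<in> H" "blinfun_apply k y = blinfun_apply (h n) y" "norm (k - id_blinfun) \<le> norm (h n - E)"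
    using norm_compose_inverse[of "h n" E y] E g by (auto simp: h_def)
  ultimately show False using gmin[of k "r (q n)"] by (auto simp: h_def)
qed

end

subsection \<open>Alignment\<close>

lemma qdist_eqI:
  assumes "p \<in> A" "q \<in> B" "\<And>p' q'. p' \<in> A \<Longrightarrow> q' \<in> B \<Longrightarrow> dist p q \<le> dist p' q'"
  shows "qdist A B = dist p q"
  unfolding qdist_def by (rule cInf_eq_minimum) (use assms in blast)+

lemma orth_group_simps:
  assumes "orth_group G" "g \<in> G"
  shows "linear g" "g x \<bullet> g y = x \<bullet> y" "norm (g x) = norm x" "inv g (g x) = x" "g (inv g x) = x"
    "inv g \<in> G" "g x \<bullet> y = x \<bullet> inv g y" "bij g"
proof -
  have o: "orthogonal_transformation g" using assms by (simp add: orth_group_def)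
  then show lin: "linear g" and inn: "g x \<bullet> g y = x \<bullet> y" for x y by (simp_all add: orthogonal_transformation_def)
  show "norm (g x) = norm x" using o by (simp add: orthogonal_transformation)
  show bij: "bij g" using o by (rule orthogonal_transformation_bij)
  then show "inv g (g x) = x" by (simp add: bij_is_inj)
  show gi: "g (inv g x) = x" for x using bij by (simp add: bij_is_surj surj_f_inv_f)
  show "inv g \<in> G" using assms by (simp add: orth_group_def)
  show "g x \<bullet> y = x \<bullet> inv g y" using inn[of x "inv g y"] gi by simp
qed

locale closed_orbit_group =
  fixes G :: "('a::euclidean_space \<Rightarrow> 'a) set"
  assumes grp: "orth_group G" and closed_orbits: "closed (orb G x)"
begin

lemmas act = orth_group_simps[OF grp]

lemma id_mem: "id \<in> G" and comp_mem: "g \<in> G \<Longrightarrow> h \<in> G \<Longrightarrow> g \<circ> h \<in> G"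
  using grp by (auto simp: orth_group_def)

lemma compact_orb: "compact (orb G x)"
  unfolding compact_eq_bounded_closed
  using closed_orbits act(3) by (auto simp: orb_def bounded_iff intro!: exI[of _ "norm x"])

lemma orb_self: "x \<in> orb G x"
  unfolding orb_def using id_mem by (metis id_apply image_eqI)

lemma orb_mem: "g \<in> G \<Longrightarrow> g x \<in> orb G x"
  by (auto simp: orb_def)

lemma orb_act: "g \<in> G \<Longrightarrow> orb G (g x) = orb G x"
proof -
  assume g: "g \<in> G"
  have "h (g x) \<in> orb G x" if "h \<in> G" for h
    using comp_mem[OF that g] by (metis comp_apply image_eqI orb_def)
  moreover have "h x \<in> orb G (g x)" if "h \<in> G" for h
    using comp_mem[OF that act(6)[OF g]] act(4)[OF g] unfolding orb_def
    by (intro image_eqI[of _ _ "h \<circ> inv g"]) auto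
  ultimately show ?thesis by (auto simp: orb_def)
qed

section \<open>Max filtering as a function of two vectors\<close>

definition mf :: "'a \<Rightarrow> 'a \<Rightarrow> real" where "mf x y = maxfilt (orb G x) (orb G y)"

text \<open>Compactness of the orbit of \<open>x\<close> gives a maximizer. Varying the first
  argument alone suffices, because \<open>k\<close> moves to the other factor as its
  inverse.\<close>

lemma mf_attained_all:
  obtains g where "g \<in> G" "mf x y = g x \<bullet> y" "\<And>h k. h \<in> G \<Longrightarrow> k \<in> G \<Longrightarrow> h x \<bullet> k y \<le> g x \<bullet> y"
proof -
  have "continuous_on (orb G x) (\<lambda>p. p \<bullet> y)" by (intro continuous_intros)
  then obtain p where p: "p \<in> orb G x" "\<And>q. q \<in> orb G x \<Longrightarrow> q \<bullet> y \<le> p \<bullet> y"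
    using continuous_attains_sup[OF compact_orb] orb_self by (metis empty_iff)
  then obtain g where g: "g \<in> G" "p = g x" by (auto simp: orb_def)
  have le: "h x \<bullet> k y \<le> g x \<bullet> y" if "h \<in> G" "k \<in> G" for h k
  proof -
    have "h x \<bullet> k y = (inv k \<circ> h) x \<bullet> y"
      using act[OF that(2)] by (metis comp_apply inner_commute)
    also have "\<dots> \<le> g x \<bullet> y"
      unfolding g(2)[symmetric] by (rule p(2)[OF orb_mem[OF comp_mem[OF act(6)[OF that(2)] that(1)]]])
    finally show ?thesis .
  qed
  have "mf x y = g x \<bullet> y" unfolding mf_def maxfilt_def
  proof (rule cSup_eq_maximum)
    show "g x \<bullet> y \<in> {p \<bullet> q |p q. p \<in> orb G x \<and> q \<in> orb G y}"
      using orb_mem[OF g(1), of x] orb_self[of y] by blast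
  qed (use le in \<open>auto simp: orb_def\<close>)
  then show ?thesis using that g le by blast
qed

lemma mf_attained: "\<exists>g\<in>G. mf x y = g x \<bullet> y"
  by (rule mf_attained_all[of x y]) blast

lemma mf_ge: "g \<in> G \<Longrightarrow> h \<in> G \<Longrightarrow> g x \<bullet> h y \<le> mf x y"
  by (rule mf_attained_all[of x y]) simp

lemma mf_ge_left: "g \<in> G \<Longrightarrow> g x \<bullet> y \<le> mf x y"
  using mf_ge[OF _ id_mem] by simp

lemma mf_ge_inner: "x \<bullet> y \<le> mf x y"
  using mf_ge[OF id_mem id_mem] by simp

lemma mf_act: "g \<in> G \<Longrightarrow> mf (g x) y = mf x y" "g \<in> G \<Longrightarrow> mf x (g y) = mf x y"
  by (simp_all add: mf_def orb_act)

lemma mf_commute: "mf x y = mf y x"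
  unfolding mf_def maxfilt_def by (rule arg_cong[where f = Sup]) (use inner_commute in blast)

lemma mf_le: "mf x y \<le> norm x * norm y"
proof -
  obtain g where g: "g \<in> G" "mf x y = g x \<bullet> y" using mf_attained by blast
  then show ?thesis using norm_cauchy_schwarz[of "g x" y] act(3)[OF g(1)] by simp
qed

lemma mf_self: "mf x x = x \<bullet> x"
  using mf_le[of x x] mf_ge_inner[of x x] by (simp add: power2_norm_eq_inner power2_eq_square[symmetric])

text \<open>Norms are constant on orbits, so minimizing the distance amounts to maximizing the inner
  product.\<close>

lemma qdist_orb: "(qdist (orb G x) (orb G y))\<^sup>2 = x \<bullet> x + y \<bullet> y - 2 * mf x y"
proof -
  obtain g where g: "g \<in> G" "mf x y = g x \<bullet> y" using mf_attained by blast
  have sq: "(dist (h x) (k y))\<^sup>2 = x \<bullet> x + y \<bullet> y - 2 * (h x \<bullet> k y)" if "h \<in> G" "k \<in> G" for h k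
    using act(2)[OF that(1)] act(2)[OF that(2)]
    by (simp add: dist_norm power2_norm_eq_inner inner_diff_left inner_diff_right inner_commute)
  have "qdist (orb G x) (orb G y) = dist (g x) (id y)"
  proof (rule qdist_eqI)
    show "g x \<in> orb G x" "id y \<in> orb G y" using g orb_self by (auto simp: orb_def)
    fix p q assume "p \<in> orb G x" "q \<in> orb G y"
    then obtain h k where hk: "h \<in> G" "k \<in> G" "p = h x" "q = k y" by (auto simp: orb_def)
    have "(dist (g x) (id y))\<^sup>2 \<le> (dist p q)\<^sup>2"
      using sq[OF g(1) id_mem] sq[OF hk(1,2)] hk mf_ge[OF hk(1,2), of x y] g by simp
    then show "dist (g x) (id y) \<le> dist p q" by (rule power2_le_imp_le) simp
  qed
  then show ?thesis using sq[OF g(1) id_mem] g by simp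
qed

section \<open>Aligned pairs and maximal aligned sets\<close>

definition aligned :: "'a \<Rightarrow> 'a \<Rightarrow> bool" where "aligned x y \<longleftrightarrow> mf x y = x \<bullet> y"

lemma aligned_iff: "aligned x y \<longleftrightarrow> (\<forall>g\<in>G. g x \<bullet> y \<le> x \<bullet> y)"
proof
  assume "aligned x y"
  then show "\<forall>g\<in>G. g x \<bullet> y \<le> x \<bullet> y" using mf_ge_left unfolding aligned_def by metis
next
  assume *: "\<forall>g\<in>G. g x \<bullet> y \<le> x \<bullet> y"
  obtain g where "g \<in> G" "mf x y = g x \<bullet> y" using mf_attained by blast
  then show "aligned x y" using * mf_ge_inner[of x y] unfolding aligned_def by force
qed

lemma aligned_commute: "aligned x y \<longleftrightarrow> aligned y x"
  by (simp add: aligned_def mf_commute inner_commute)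

lemma aligned_self: "aligned x x"
  by (simp add: aligned_def mf_self)

lemma aligned_act: "g \<in> G \<Longrightarrow> aligned (g x) (g y) \<longleftrightarrow> aligned x y"
  by (simp add: aligned_def mf_act act(2))

lemma aligned_zero: "aligned 0 x"
  by (simp add: aligned_iff linear_0[OF act(1)])

text \<open>The equality case of Cauchy-Schwarz. Hence a pairwise aligned set contains at most one
  point of each orbit.\<close>

lemma aligned_orbit_eq: "aligned x (g x) \<Longrightarrow> g \<in> G \<Longrightarrow> g x = x"
proof -
  assume "aligned x (g x)" and g: "g \<in> G"
  then have "x \<bullet> g x = x \<bullet> x" by (simp add: aligned_def mf_act mf_self)
  then have "(g x - x) \<bullet> (g x - x) = 0" using act(2)[OF g, of x x]
    by (simp add: inner_diff_left inner_diff_right inner_commute)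
  then show ?thesis by simp
qed

lemma closed_aligned: "closed {u. aligned x u}"
proof -
  have "{u. aligned x u} = (\<Inter>g\<in>G. {u. g x \<bullet> u \<le> x \<bullet> u})" by (auto simp: aligned_iff)
  moreover have "closed {u. g x \<bullet> u \<le> x \<bullet> u}" for g by (intro closed_Collect_le continuous_intros)
  ultimately show ?thesis by auto
qed

definition aligned_set :: "'a set \<Rightarrow> bool" where
  "aligned_set A \<longleftrightarrow> (\<forall>a\<in>A. \<forall>b\<in>A. aligned a b)"

definition max_aligned :: "'a set \<Rightarrow> bool" where
  "max_aligned A \<longleftrightarrow> aligned_set A \<and> (\<forall>B. aligned_set B \<longrightarrow> A \<subseteq> B \<longrightarrow> B = A)"

lemma aligned_set_insert: "aligned_set A \<Longrightarrow> (\<And>a. a \<in> A \<Longrightarrow> aligned a u) \<Longrightarrow> aligned_set (insert u A)"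
proof -
  assume A: "aligned_set A" and u: "\<And>a. a \<in> A \<Longrightarrow> aligned a u"
  have "aligned u a" if "a \<in> A" for a using u[OF that] by (simp add: aligned_commute[of u a])
  then show ?thesis using A u aligned_self[of u] by (simp add: aligned_set_def)
qed

lemma max_aligned_mem: "max_aligned A \<Longrightarrow> (\<And>a. a \<in> A \<Longrightarrow> aligned a u) \<Longrightarrow> u \<in> A"
proof -
  assume A: "max_aligned A" and u: "\<And>a. a \<in> A \<Longrightarrow> aligned a u"
  have "aligned_set (insert u A)" using A u by (intro aligned_set_insert) (auto simp: max_aligned_def)
  then have "insert u A = A" using A subset_insertI[of A u] by (simp add: max_aligned_def)
  then show ?thesis by auto
qed

lemma max_aligned_unique: "max_aligned A \<Longrightarrow> a \<in> A \<Longrightarrow> g \<in> G \<Longrightarrow> g a \<in> A \<Longrightarrow> g a = a"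
  by (rule aligned_orbit_eq) (simp_all add: max_aligned_def aligned_set_def)

text \<open>Zorn's lemma applies because alignment constrains only pairs and so passes to unions of
  chains.\<close>

lemma max_aligned_extend:
  assumes "aligned_set F"
  obtains A where "max_aligned A" "F \<subseteq> A"
proof -
  have "\<exists>M\<in>{B. aligned_set B \<and> F \<subseteq> B}. \<forall>X\<in>{B. aligned_set B \<and> F \<subseteq> B}. M \<subseteq> X \<longrightarrow> X = M"
  proof (rule subset_Zorn_nonempty)
    fix \<C> assume C: "\<C> \<noteq> {}" "subset.chain {B. aligned_set B \<and> F \<subseteq> B} \<C>"
    have "aligned a b" if "a \<in> X" "X \<in> \<C>" "b \<in> Y" "Y \<in> \<C>" for a b X Y
    proof -
      have "X \<subseteq> Y \<or> Y \<subseteq> X" using C(2) that by (auto simp: subset_chain_def)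
      moreover have "aligned_set X" "aligned_set Y" using C(2) that by (auto simp: subset_chain_def)
      ultimately show ?thesis using that unfolding aligned_set_def by blast
    qed
    then have "aligned_set (\<Union>\<C>)" by (auto simp: aligned_set_def)
    moreover have "F \<subseteq> \<Union>\<C>" using C unfolding subset_chain_def by blast
    ultimately show "\<Union>\<C> \<in> {B. aligned_set B \<and> F \<subseteq> B}" by simp
  qed (use assms in auto)
  then obtain M where M: "M \<in> {B. aligned_set B \<and> F \<subseteq> B}"
    and max: "\<forall>X\<in>{B. aligned_set B \<and> F \<subseteq> B}. M \<subseteq> X \<longrightarrow> X = M" by (rule bexE)
  have "max_aligned M" unfolding max_aligned_def
  proof (intro conjI allI impI)
    show "B = M" if "aligned_set B" "M \<subseteq> B" for B using max M that by auto
  qed (use M in simp)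
  then show ?thesis using that M by simp
qed

section \<open>The closure of the group as a compact group of isometries\<close>

definition Gbar :: "('a \<Rightarrow>\<^sub>L 'a) set" where "Gbar = closure (Blinfun ` G)"

lemma Blinfun_act: "g \<in> G \<Longrightarrow> blinfun_apply (Blinfun g) = g"
  using act(1) linear_conv_bounded_linear bounded_linear_Blinfun_apply by blast

lemma Gbar_seq: "h \<in> Gbar \<longleftrightarrow> (\<exists>g. (\<forall>n. g n \<in> G) \<and> (\<lambda>n. Blinfun (g n)) \<longlonglongrightarrow> h)"
proof
  assume "h \<in> Gbar"
  then obtain f where f: "\<forall>n. f n \<in> Blinfun ` G" "f \<longlonglongrightarrow> h" by (auto simp: Gbar_def closure_sequential)
  then have "\<forall>n. \<exists>a. a \<in> G \<and> f n = Blinfun a" by blast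
  then obtain g where "\<forall>n. g n \<in> G \<and> f n = Blinfun (g n)" by metis
  moreover from this have "f = (\<lambda>n. Blinfun (g n))" by auto
  ultimately show "\<exists>g. (\<forall>n. g n \<in> G) \<and> (\<lambda>n. Blinfun (g n)) \<longlonglongrightarrow> h" using f by auto
next
  assume "\<exists>g. (\<forall>n. g n \<in> G) \<and> (\<lambda>n. Blinfun (g n)) \<longlonglongrightarrow> h"
  then obtain g where "\<forall>n. g n \<in> G" "(\<lambda>n. Blinfun (g n)) \<longlonglongrightarrow> h" by blast
  then show "h \<in> Gbar" unfolding Gbar_def closure_sequential
    by (intro exI[of _ "\<lambda>n. Blinfun (g n)"]) auto
qed

lemma Gbar_G: "g \<in> G \<Longrightarrow> Blinfun g \<in> Gbar"
  unfolding Gbar_def by (rule subsetD[OF closure_subset]) (rule imageI)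

lemma Blinfun_compose_G: "g \<in> G \<Longrightarrow> h \<in> G \<Longrightarrow> Blinfun g o\<^sub>L Blinfun h = Blinfun (g \<circ> h)"
  by (rule blinfun_eqI) (simp add: Blinfun_act comp_mem)

text \<open>Closed orbits do not force \<open>G\<close> to be closed, but they keep limits of group
  elements inside the orbits. Passing to the closure therefore enlarges no orbit.\<close>

lemma Gbar_orb: "h \<in> Gbar \<Longrightarrow> blinfun_apply h x \<in> orb G x"
proof -
  assume "h \<in> Gbar"
  then obtain g where g: "\<forall>n. g n \<in> G" "(\<lambda>n. Blinfun (g n)) \<longlonglongrightarrow> h" unfolding Gbar_seq by blast
  have "blinfun_apply (Blinfun (g n)) x \<in> orb G x" for n
    using g by (simp add: Blinfun_act orb_def)
  then show ?thesis
    using closed_sequentially[OF closed_orbits _ blinfun.tendsto[OF g(2) tendsto_const]] by simp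
qed

lemma Gbar_isometry: "h \<in> Gbar \<Longrightarrow> norm (blinfun_apply h x) = norm x"
  using Gbar_orb[of h x] act(3) by (auto simp: orb_def)

lemma compact_Gbar: "compact Gbar"
proof -
  have "norm h \<le> 1" if "h \<in> Gbar" for h
    using that by (intro norm_blinfun_bound) (simp_all add: Gbar_isometry)
  then have "bounded Gbar" unfolding bounded_iff by blast
  then show ?thesis by (simp add: compact_eq_bounded_closed Gbar_def)
qed

sublocale Gbar: compact_isometry_group Gbar
proof
  show "compact Gbar" by (rule compact_Gbar)
  have "Blinfun id = (id_blinfun :: 'a \<Rightarrow>\<^sub>L 'a)"
    by (rule blinfun_eqI) (simp add: Blinfun_act[OF id_mem])
  then show "id_blinfun \<in> Gbar" using Gbar_G[OF id_mem] by simp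
  show "h o\<^sub>L k \<in> Gbar" if hk: "h \<in> Gbar" "k \<in> Gbar" for h k
  proof -
    obtain a b where ab: "\<forall>n. a n \<in> G" "\<forall>n. b n \<in> G"
      "(\<lambda>n. Blinfun (a n)) \<longlonglongrightarrow> h" "(\<lambda>n. Blinfun (b n)) \<longlonglongrightarrow> k" using hk Gbar_seq by metis
    have "(\<lambda>n. Blinfun (a n) o\<^sub>L Blinfun (b n)) \<longlonglongrightarrow> (h o\<^sub>L k)"
      by (rule bounded_bilinear.tendsto[OF bounded_bilinear_blinfun_compose ab(3,4)])
    then have "(\<lambda>n. Blinfun (a n \<circ> b n)) \<longlonglongrightarrow> (h o\<^sub>L k)" using ab by (simp add: Blinfun_compose_G)
    moreover have "\<forall>n. a n \<circ> b n \<in> G" using ab comp_mem by blast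
    ultimately show ?thesis unfolding Gbar_seq by (intro exI[of _ "\<lambda>n. a n \<circ> b n"]) blast
  qed
  show "\<exists>k\<in>Gbar. h o\<^sub>L k = id_blinfun \<and> k o\<^sub>L h = id_blinfun" if h: "h \<in> Gbar" for h
  proof -
    obtain a where a: "\<forall>n. a n \<in> G" "(\<lambda>n. Blinfun (a n)) \<longlonglongrightarrow> h" using h unfolding Gbar_seq by blast
    \<comment> \<open>The inverse of a limit is found as a subsequential limit of inverses.\<close>
    have "\<forall>n. Blinfun (inv (a n)) \<in> Gbar" using a act(6) Gbar_G by blast
    then obtain k r where k: "k \<in> Gbar" "strict_mono r" "((\<lambda>n. Blinfun (inv (a n))) \<circ> r) \<longlonglongrightarrow> k"
      using compact_Gbar unfolding compact_def by metis
    have e: "Blinfun (a n) o\<^sub>L Blinfun (inv (a n)) = id_blinfun" "Blinfun (inv (a n)) o\<^sub>L Blinfun (a n) = id_blinfun" for n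
      using a act(4-6) by (auto intro!: blinfun_eqI simp: Blinfun_act)
    have "(\<lambda>n. ((\<lambda>n. Blinfun (a n)) \<circ> r) n o\<^sub>L ((\<lambda>n. Blinfun (inv (a n))) \<circ> r) n) \<longlonglongrightarrow> (h o\<^sub>L k)"
      by (rule bounded_bilinear.tendsto[OF bounded_bilinear_blinfun_compose LIMSEQ_subseq_LIMSEQ[OF a(2) k(2)] k(3)])
    then have "h o\<^sub>L k = id_blinfun" by (simp add: e LIMSEQ_const_iff)
    moreover have "(\<lambda>n. ((\<lambda>n. Blinfun (inv (a n))) \<circ> r) n o\<^sub>L ((\<lambda>n. Blinfun (a n)) \<circ> r) n) \<longlonglongrightarrow> (k o\<^sub>L h)"
      by (rule bounded_bilinear.tendsto[OF bounded_bilinear_blinfun_compose k(3) LIMSEQ_subseq_LIMSEQ[OF a(2) k(2)]])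
    then have "k o\<^sub>L h = id_blinfun" by (simp add: e LIMSEQ_const_iff)
    ultimately show ?thesis using k by blast
  qed
  show "norm (blinfun_apply h x) = norm x" if "h \<in> Gbar" for h x
    using that by (rule Gbar_isometry)
qed

text \<open>The numbers \<open>\<langle>a - h a, b\<rangle>\<close> and \<open>\<langle>a, b - h b\<rangle>\<close> are nonnegative by alignment, and their sum is
  \<open>\<langle>h a - a, h b - b\<rangle>\<close>.\<close>

lemma aligned_displacement:
  assumes "aligned a b" "h \<in> Gbar"
  shows "\<bar>(blinfun_apply h a - a) \<bullet> b\<bar> \<le> norm a * norm b * (norm (h - id_blinfun))\<^sup>2"
proof -
  have "orthogonal_transformation (blinfun_apply h)"
    unfolding orthogonal_transformation using Gbar_isometry[OF assms(2)]
    by (simp add: blinfun.bounded_linear_right bounded_linear.linear)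
  then have inn: "blinfun_apply h a \<bullet> blinfun_apply h b = a \<bullet> b" by (simp add: orthogonal_transformation_def)
  have 1: "blinfun_apply h a \<bullet> b \<le> a \<bullet> b"
    using Gbar_orb[OF assms(2), of a] assms(1) by (auto simp: aligned_iff orb_def)
  have 2: "a \<bullet> blinfun_apply h b \<le> a \<bullet> b"
    using Gbar_orb[OF assms(2), of b] assms(1) aligned_commute[of a b]
    by (auto simp: aligned_iff orb_def inner_commute)
  have d: "norm (blinfun_apply h x - x) \<le> norm (h - id_blinfun) * norm x" for x
    using norm_blinfun[of "h - id_blinfun" x] by (simp add: blinfun.diff_left)
  have "(a \<bullet> b - blinfun_apply h a \<bullet> b) + (a \<bullet> b - a \<bullet> blinfun_apply h b)
      = (blinfun_apply h a - a) \<bullet> (blinfun_apply h b - b)"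
    by (simp add: inner_diff_left inner_diff_right inn)
  also have "\<dots> \<le> norm (blinfun_apply h a - a) * norm (blinfun_apply h b - b)" by (rule norm_cauchy_schwarz)
  also have "\<dots> \<le> (norm (h - id_blinfun) * norm a) * (norm (h - id_blinfun) * norm b)"
    by (intro mult_mono d) auto
  finally have "a \<bullet> b - blinfun_apply h a \<bullet> b \<le> norm a * norm b * (norm (h - id_blinfun))\<^sup>2"
    using 2 by (simp add: power2_eq_square algebra_simps)
  then show ?thesis using 1 by (simp add: inner_diff_left)
qed

text \<open>Alignment itself does not survive linear combinations, but the second-order bound does:
  for either argument fixed, the other arguments satisfying it form a subspace. Only the constant
  depends on the two vectors.\<close>

lemma aligned_span_displacement:
  assumes A: "aligned_set A" and "y \<in> span A" "z \<in> span A"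
  shows "\<exists>K\<ge>0. \<forall>h\<in>Gbar. \<bar>(blinfun_apply h y - y) \<bullet> z\<bar> \<le> K * (norm (h - id_blinfun))\<^sup>2"
proof -
  define P where "P y z \<longleftrightarrow> (\<exists>K\<ge>0. \<forall>h\<in>Gbar. \<bar>(blinfun_apply h y - y) \<bullet> z\<bar> \<le> K * (norm (h - id_blinfun))\<^sup>2)" for y z
  have base: "P a b" if "a \<in> A" "b \<in> A" for a b
  proof -
    have "aligned a b" using A that by (simp add: aligned_set_def)
    then show ?thesis unfolding P_def
      using aligned_displacement[of a b] by (intro exI[of _ "norm a * norm b"]) simp
  qed
  have right: "subspace {z. P y z}" for y
  proof (rule subspaceI)
    show "0 \<in> {z. P y z}" by (auto simp: P_def intro!: exI[of _ 0])
    show "u + v \<in> {z. P y z}" if uv: "u \<in> {z. P y z}" "v \<in> {z. P y z}" for u v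
    proof -
      obtain K L where K: "K \<ge> 0" "\<forall>h\<in>Gbar. \<bar>(blinfun_apply h y - y) \<bullet> u\<bar> \<le> K * (norm (h - id_blinfun))\<^sup>2"
        and L: "L \<ge> 0" "\<forall>h\<in>Gbar. \<bar>(blinfun_apply h y - y) \<bullet> v\<bar> \<le> L * (norm (h - id_blinfun))\<^sup>2"
        using uv unfolding P_def by auto
      have "\<bar>(blinfun_apply h y - y) \<bullet> (u + v)\<bar> \<le> (K + L) * (norm (h - id_blinfun))\<^sup>2" if "h \<in> Gbar" for h
      proof -
        have "\<bar>(blinfun_apply h y - y) \<bullet> (u + v)\<bar> \<le> \<bar>(blinfun_apply h y - y) \<bullet> u\<bar> + \<bar>(blinfun_apply h y - y) \<bullet> v\<bar>"
          by (simp add: inner_add_right)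
        also have "\<dots> \<le> K * (norm (h - id_blinfun))\<^sup>2 + L * (norm (h - id_blinfun))\<^sup>2"
          using K L that by (intro add_mono) auto
        finally show ?thesis by (simp add: distrib_right)
      qed
      then show ?thesis unfolding P_def using K L by (auto intro!: exI[of _ "K + L"])
    qed
    show "c *\<^sub>R u \<in> {z. P y z}" if u: "u \<in> {z. P y z}" for c u
    proof -
      obtain K where K: "K \<ge> 0" "\<forall>h\<in>Gbar. \<bar>(blinfun_apply h y - y) \<bullet> u\<bar> \<le> K * (norm (h - id_blinfun))\<^sup>2"
        using u unfolding P_def by auto
      have "\<bar>(blinfun_apply h y - y) \<bullet> (c *\<^sub>R u)\<bar> \<le> (\<bar>c\<bar> * K) * (norm (h - id_blinfun))\<^sup>2" if "h \<in> Gbar" for h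
        using mult_left_mono[OF K(2)[rule_format, OF that], of "\<bar>c\<bar>"] by (simp add: abs_mult mult.assoc)
      then show ?thesis unfolding P_def using K by (auto intro!: exI[of _ "\<bar>c\<bar> * K"])
    qed
  qed
  have left: "subspace {y. P y z}" for z
  proof (rule subspaceI)
    show "0 \<in> {y. P y z}" by (auto simp: P_def intro!: exI[of _ 0])
    show "u + v \<in> {y. P y z}" if uv: "u \<in> {y. P y z}" "v \<in> {y. P y z}" for u v
    proof -
      obtain K L where K: "K \<ge> 0" "\<forall>h\<in>Gbar. \<bar>(blinfun_apply h u - u) \<bullet> z\<bar> \<le> K * (norm (h - id_blinfun))\<^sup>2"
        and L: "L \<ge> 0" "\<forall>h\<in>Gbar. \<bar>(blinfun_apply h v - v) \<bullet> z\<bar> \<le> L * (norm (h - id_blinfun))\<^sup>2"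
        using uv unfolding P_def by auto
      have "\<bar>(blinfun_apply h (u + v) - (u + v)) \<bullet> z\<bar> \<le> (K + L) * (norm (h - id_blinfun))\<^sup>2" if "h \<in> Gbar" for h
      proof -
        have "(blinfun_apply h (u + v) - (u + v)) \<bullet> z = (blinfun_apply h u - u) \<bullet> z + (blinfun_apply h v - v) \<bullet> z"
          by (simp add: blinfun.add_right inner_add_left inner_diff_left)
        then have "\<bar>(blinfun_apply h (u + v) - (u + v)) \<bullet> z\<bar> \<le> \<bar>(blinfun_apply h u - u) \<bullet> z\<bar> + \<bar>(blinfun_apply h v - v) \<bullet> z\<bar>"
          by simp
        also have "\<dots> \<le> K * (norm (h - id_blinfun))\<^sup>2 + L * (norm (h - id_blinfun))\<^sup>2"
          using K L that by (intro add_mono) auto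
        finally show ?thesis by (simp add: distrib_right)
      qed
      then show ?thesis unfolding P_def using K L by (auto intro!: exI[of _ "K + L"])
    qed
    show "c *\<^sub>R u \<in> {y. P y z}" if u: "u \<in> {y. P y z}" for c u
    proof -
      obtain K where K: "K \<ge> 0" "\<forall>h\<in>Gbar. \<bar>(blinfun_apply h u - u) \<bullet> z\<bar> \<le> K * (norm (h - id_blinfun))\<^sup>2"
        using u unfolding P_def by auto
      have "\<bar>(blinfun_apply h (c *\<^sub>R u) - c *\<^sub>R u) \<bullet> z\<bar> \<le> (\<bar>c\<bar> * K) * (norm (h - id_blinfun))\<^sup>2" if "h \<in> Gbar" for h
      proof -
        have "(blinfun_apply h (c *\<^sub>R u) - c *\<^sub>R u) \<bullet> z = c * ((blinfun_apply h u - u) \<bullet> z)"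
          by (simp add: blinfun.scaleR_right inner_diff_left right_diff_distrib)
        then show ?thesis
          using mult_left_mono[OF K(2)[rule_format, OF that], of "\<bar>c\<bar>"] by (simp add: abs_mult mult.assoc)
      qed
      then show ?thesis unfolding P_def using K by (auto intro!: exI[of _ "\<bar>c\<bar> * K"])
    qed
  qed
  have "P a z" if "a \<in> A" for a
    using span_induct[OF assms(3) right[of a]] base that by blast
  then have "P y z" using span_induct[OF assms(2) left[of z]] by blast
  then show ?thesis by (simp add: P_def)
qed

text \<open>Replace \<open>g\<close> by an element of the closure with the same value at
  \<open>y\<close> whose distance from the identity is \<open>O(|g y - y|)\<close>. A bound in terms
  of the group thus becomes one in terms of the orbit.\<close>

lemma aligned_span_quadratic:
  assumes A: "aligned_set A" and "y \<in> span A" "z \<in> span A"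
  shows "\<exists>C\<ge>0. \<forall>g\<in>G. \<bar>(g y - y) \<bullet> z\<bar> \<le> C * (norm (g y - y))\<^sup>2"
proof -
  obtain K where K: "K \<ge> 0" "\<forall>h\<in>Gbar. \<bar>(blinfun_apply h y - y) \<bullet> z\<bar> \<le> K * (norm (h - id_blinfun))\<^sup>2"
    using aligned_span_displacement[OF assms] by (elim exE conjE) (rule that)
  obtain L where L: "L \<ge> 0" "\<forall>h\<in>Gbar. \<exists>k\<in>Gbar. blinfun_apply k y = blinfun_apply h y \<and>
      norm (k - id_blinfun) \<le> L * norm (blinfun_apply h y - y)"
    using Gbar.orbit_lift_Lipschitz[of y] by (elim exE conjE) (rule that)
  have "\<bar>(g y - y) \<bullet> z\<bar> \<le> (K * L\<^sup>2) * (norm (g y - y))\<^sup>2" if g: "g \<in> G" for g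
  proof -
    obtain k where k: "k \<in> Gbar" "blinfun_apply k y = g y" "norm (k - id_blinfun) \<le> L * norm (g y - y)"
      using L(2) Gbar_G[OF g] Blinfun_act[OF g] by metis
    have "\<bar>(g y - y) \<bullet> z\<bar> \<le> K * (norm (k - id_blinfun))\<^sup>2" using K k by metis
    also have "\<dots> \<le> K * (L * norm (g y - y))\<^sup>2" using k K by (intro mult_left_mono power_mono) auto
    finally show ?thesis by (simp add: power_mult_distrib mult.assoc)
  qed
  then show ?thesis using K by (intro exI[of _ "K * L\<^sup>2"]) auto
qed

text \<open>Along a curve in the orbit, \<open>f\<close> is minimal at \<open>0\<close>. The squared
  displacement contributes nothing to the derivative there, which leaves
  \<open>- (v \<bullet> z) = 0\<close>.\<close>

lemma tangent_orthogonal_span: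
  assumes A: "aligned_set A" and y: "y \<in> span A" and z: "z \<in> span A" and v: "v \<in> tangent_space (orb G y) y"
  shows "orthogonal v z"
proof -
  obtain C where C: "C \<ge> 0" "\<forall>g\<in>G. \<bar>(g y - y) \<bullet> z\<bar> \<le> C * (norm (g y - y))\<^sup>2"
    using aligned_span_quadratic[OF A y z] by (elim exE conjE) (rule that)
  obtain \<gamma> where \<gamma>: "\<And>t::real. \<gamma> t \<in> orb G y" "\<gamma> 0 = y" "(\<gamma> has_vector_derivative v) (at 0)"
    using v by (auto simp: tangent_space_def)
  define f where "f t = C * ((\<gamma> t - y) \<bullet> (\<gamma> t - y)) - (\<gamma> t - y) \<bullet> z" for t
  have g: "(\<gamma> has_derivative (\<lambda>t. t *\<^sub>R v)) (at 0)"
    using \<gamma>(3) by (simp add: has_vector_derivative_def)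
  have "(f has_derivative (\<lambda>t. - (v \<bullet> z) * t)) (at 0)"
    unfolding f_def
    by (rule derivative_eq_intros g refl | simp add: \<gamma>(2) mult.commute)+
  then have "(f has_real_derivative - (v \<bullet> z)) (at 0)" by (simp only: has_field_derivative_def)
  moreover have "f 0 \<le> f t" for t
  proof -
    obtain g where "g \<in> G" "\<gamma> t = g y" using \<gamma>(1)[of t] by (auto simp: orb_def)
    then have "(\<gamma> t - y) \<bullet> z \<le> C * ((\<gamma> t - y) \<bullet> (\<gamma> t - y))"
      using C(2)[rule_format, of g] by (simp add: power2_norm_eq_inner)
    then show ?thesis by (simp add: f_def \<gamma>(2))
  qed
  ultimately have "- (v \<bullet> z) = 0" using DERIV_local_min[of f "- (v \<bullet> z)" 0 1] by simp
  then show ?thesis by (simp add: orthogonal_def)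
qed

text \<open>Moving \<open>y\<close> to \<open>g y\<close> costs
  \<open>y \<bullet> y - g y \<bullet> y\<close>, which is half of \<open>|g y - y|^2\<close>. The
  gain from \<open>s *\<^sub>R z\<close> is at most \<open>s * C * |g y - y|^2\<close>, so any
  \<open>s\<close> with \<open>s * C \<le> 1 / 2\<close> works.\<close>

lemma aligned_small_step:
  assumes A: "aligned_set A" and y: "y \<in> span A" and z: "z \<in> span A"
  shows "\<exists>s>0. aligned y (y + s *\<^sub>R z)"
proof -
  obtain C where C: "C \<ge> 0" "\<forall>g\<in>G. \<bar>(g y - y) \<bullet> z\<bar> \<le> C * (norm (g y - y))\<^sup>2"
    using aligned_span_quadratic[OF A y z] by (elim exE conjE) (rule that)
  define s where "s = 1 / (2 * (C + 1))"
  have s: "s > 0" "s * C \<le> 1 / 2" using C(1) by (simp_all add: s_def field_simps)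
  have "g y \<bullet> (y + s *\<^sub>R z) \<le> y \<bullet> (y + s *\<^sub>R z)" if g: "g \<in> G" for g
  proof -
    have n: "(norm (g y - y))\<^sup>2 = 2 * (y \<bullet> y - g y \<bullet> y)"
      using act(2)[OF g, of y y] by (simp add: power2_norm_eq_inner inner_diff_left inner_diff_right inner_commute)
    have "s * ((g y - y) \<bullet> z) \<le> s * (C * (norm (g y - y))\<^sup>2)"
      using C g s by (intro mult_left_mono) auto
    also have "\<dots> \<le> 1 / 2 * (norm (g y - y))\<^sup>2"
      using mult_right_mono[OF s(2), of "(norm (g y - y))\<^sup>2"] by (simp add: mult.assoc)
    finally show ?thesis using n by (simp add: inner_add_right inner_diff_left algebra_simps)
  qed
  then show ?thesis using s by (auto simp: aligned_iff)
qed

end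

subsection \<open>Consequences of positive definiteness\<close>

locale pd_group = closed_orbit_group +
  assumes pd: "pd_kernel_on (range (orb G)) maxfilt"
begin

text \<open>The coefficients \<open>s, s, -s, 1\<close> at \<open>x, y, x + y, u\<close> give a quadratic form that is affine in \<open>s\<close>.\<close>

lemma mf_add:
  assumes xy: "aligned x y"
  shows "mf (x + y) u = mf x u + mf y u"
proof -
  define z where "z = x + y"
  have le: "mf p (a + b) \<le> mf p a + mf p b" for p a b
  proof -
    obtain g where "g \<in> G" "mf p (a + b) = g p \<bullet> (a + b)" using mf_attained by blast
    then show ?thesis using mf_ge_left[of g p a] mf_ge_left[of g p b] by (simp add: inner_add_right)
  qed
  have xx: "mf x x = x \<bullet> x" "mf y y = y \<bullet> y" "mf z z = z \<bullet> z" "mf x y = x \<bullet> y" "mf y x = x \<bullet> y"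
    using xy by (simp_all add: mf_self aligned_def mf_commute[of y x])
  have xz: "mf x z = x \<bullet> z" using le[of x x y] mf_ge_inner[of x z] xx by (simp add: z_def inner_add_right)
  have yz: "mf y z = y \<bullet> z" using le[of y x y] mf_ge_inner[of y z] xx by (simp add: z_def inner_add_right inner_commute)
  define D where "D = mf x u + mf y u - mf z u"
  have Q: "0 \<le> 2 * s * D + mf u u" for s :: real
  proof -
    define p where "p i = orb G ([x, y, z, u] ! i)" for i
    define c where "c i = [s, s, - s, 1] ! i" for i
    have "0 \<le> (\<Sum>i<4. \<Sum>j<4. c i * c j * maxfilt (p i) (p j))"
      using pd unfolding pd_kernel_on_def by (auto simp: p_def)
    also have "\<dots> = s * s * (x \<bullet> x + y \<bullet> y + z \<bullet> z + 2 * (x \<bullet> y) - 2 * (x \<bullet> z) - 2 * (y \<bullet> z)) + 2 * s * D + mf u u"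
      using xx xz yz mf_commute[of z x] mf_commute[of z y] mf_commute[of u x] mf_commute[of u y] mf_commute[of u z]
      by (simp add: p_def c_def numeral_eq_Suc mf_def[symmetric] D_def algebra_simps)
    also have "x \<bullet> x + y \<bullet> y + z \<bullet> z + 2 * (x \<bullet> y) - 2 * (x \<bullet> z) - 2 * (y \<bullet> z) = 0"
      by (simp add: z_def inner_add_left inner_add_right inner_commute)
    finally show ?thesis by simp
  qed
  have "D = 0"
  proof (rule ccontr)
    assume "D \<noteq> 0"
    \<comment> \<open>This choice of \<open>s\<close> gives the form the value
      \<open>-1\<close>.\<close>
    then show False using Q[of "- (mf u u + 1) / (2 * D)"] by (simp add: field_simps)
  qed
  then show ?thesis by (simp add: D_def z_def)
qed

text \<open>By additivity the defect of \<open>x + y\<close> is the sum of the defects of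
  \<open>x\<close> and \<open>y\<close>. Both are nonnegative, so the sum vanishes only if each
  does.\<close>

lemma aligned_add_iff:
  assumes "aligned x y"
  shows "aligned (x + y) u \<longleftrightarrow> aligned x u \<and> aligned y u"
  using mf_add[OF assms, of u] mf_ge_inner[of x u] mf_ge_inner[of y u]
  by (auto simp: aligned_def inner_add_left)

text \<open>Alignment with all members of a finite aligned set is thereby encoded in alignment with
  one vector, their sum.\<close>

lemma aligned_sum_iff:
  assumes "finite F" "aligned_set F"
  shows "aligned (\<Sum>F) u \<longleftrightarrow> (\<forall>f\<in>F. aligned f u)"
  using assms
proof (induction F arbitrary: u rule: finite_induct)
  case empty
  then show ?case by (simp add: aligned_zero)
next
  case (insert f F)
  have F: "aligned_set F" using insert.prems by (simp add: aligned_set_def)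
  have "aligned (\<Sum>F) f" using insert.IH[OF F] insert.prems by (simp add: aligned_set_def)
  then have "aligned f (\<Sum>F)" by (simp add: aligned_commute[of f])
  from aligned_add_iff[OF this] show ?case using insert.IH[OF F] insert.hyps by simp
qed

text \<open>For finitely many members of \<open>A\<close>, the point of the orbit that maximizes the
  inner product with their sum is aligned with each of them. The finite intersection property in the
  compact orbit extends this to all of \<open>A\<close>, and maximality applies.\<close>

lemma max_aligned_meets_orbit:
  assumes A: "max_aligned A"
  shows "\<exists>g\<in>G. g z \<in> A"
proof -
  have al: "aligned_set A" using A by (simp add: max_aligned_def)
  have "orb G z \<inter> (\<Inter>a\<in>A. {u. aligned a u}) \<noteq> {}"
  proof (rule compact_imp_fip_image)
    show "compact (orb G z)" by (rule compact_orb)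
    show "closed {u. aligned a u}" for a by (rule closed_aligned)
    fix F assume F: "finite F" "F \<subseteq> A"
    then have alF: "aligned_set F" using al by (auto simp: aligned_set_def)
    obtain g where g: "g \<in> G" "mf z (\<Sum>F) = g z \<bullet> \<Sum>F" using mf_attained by blast
    then have "aligned (g z) (\<Sum>F)" by (simp add: aligned_def mf_act)
    then have "aligned (\<Sum>F) (g z)" by (simp add: aligned_commute[of "\<Sum>F"])
    then have "\<forall>f\<in>F. aligned f (g z)" using aligned_sum_iff[OF F(1) alF] by blast
    then show "orb G z \<inter> (\<Inter>a\<in>F. {u. aligned a u}) \<noteq> {}" using orb_mem[OF g(1)] by blast
  qed
  then obtain g where "g \<in> G" "\<forall>a\<in>A. aligned a (g z)" by (auto simp: orb_def)
  then show ?thesis using max_aligned_mem[OF A, of "g z"] by blast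
qed

text \<open>The sum of a basis of the span chosen within \<open>A\<close> is regular. If
  \<open>u\<close> is aligned with it and \<open>g u\<close> lies in \<open>A\<close>, then
  \<open>u\<close> and \<open>g u\<close> have the same inner product with every basis vector. So
  \<open>u - g u\<close> is orthogonal to \<open>g u\<close>, and equality of norms forces
  \<open>u = g u\<close>.\<close>

lemma regular_point_exists:
  assumes A: "max_aligned A"
  obtains x where "x \<in> A" "\<And>u. aligned x u \<Longrightarrow> u \<in> A"
proof -
  have al: "aligned_set A" using A by (simp add: max_aligned_def)
  obtain F where F: "F \<subseteq> A" "independent F" "A \<subseteq> span F"
    using maximal_independent_subset by blast
  have fin: "finite F" using F(2) by (rule independent_imp_finite)
  have alF: "aligned_set F" using al F by (auto simp: aligned_set_def)
  have "\<Sum>F \<in> A"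
  proof (rule max_aligned_mem[OF A])
    fix a assume "a \<in> A"
    then have "aligned (\<Sum>F) a" using aligned_sum_iff[OF fin alF] al F by (auto simp: aligned_set_def)
    then show "aligned a (\<Sum>F)" by (simp add: aligned_commute[of a])
  qed
  moreover have "u \<in> A" if u: "aligned (\<Sum>F) u" for u
  proof -
    obtain g where g: "g \<in> G" "g u \<in> A" using max_aligned_meets_orbit[OF A] by blast
    have "f \<bullet> u = f \<bullet> g u" if f: "f \<in> F" for f
    proof -
      have "aligned f u" using u f aligned_sum_iff[OF fin alF] by blast
      moreover have "aligned f (g u)" using f F g al by (auto simp: aligned_set_def)
      ultimately show ?thesis by (simp add: aligned_def mf_act g)
    qed
    then have "orthogonal (u - g u) f" if "f \<in> F" for f
      using that by (simp add: orthogonal_def inner_diff_right inner_commute[of "u - g u"])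
    moreover have "g u \<in> span F" using F g by blast
    ultimately have "orthogonal (u - g u) (g u)" using orthogonal_to_span by blast
    then have "u \<bullet> g u = u \<bullet> u" using act(2)[OF g(1), of u u]
      by (simp add: orthogonal_def inner_diff_left)
    then have "(g u - u) \<bullet> (g u - u) = 0" using act(2)[OF g(1), of u u]
      by (simp add: inner_diff_left inner_diff_right inner_commute)
    then show ?thesis using g by simp
  qed
  ultimately show ?thesis using that by blast
qed

text \<open>Move a regular point of \<open>A\<close> into \<open>B\<close> by some \<open>h\<close>.
  Everything in \<open>B\<close> is aligned with it, so \<open>B\<close> is contained in
  \<open>h\<close> followed by \<open>A\<close>, that is, in the translate of \<open>A\<close>;
  maximality of \<open>B\<close> gives equality.\<close>

lemma max_aligned_conjugate:
  assumes A: "max_aligned A" and B: "max_aligned B"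
  obtains h where "h \<in> G" "B = h ` A"
proof -
  obtain x where x: "x \<in> A" "\<And>u. aligned x u \<Longrightarrow> u \<in> A" using regular_point_exists[OF A] by blast
  obtain h where h: "h \<in> G" "h x \<in> B" using max_aligned_meets_orbit[OF B] by blast
  have "b \<in> h ` A" if b: "b \<in> B" for b
  proof -
    have "aligned (h x) (h (inv h b))" using B h b act(5)[OF h(1)] by (simp add: max_aligned_def aligned_set_def)
    then have "inv h b \<in> A" using aligned_act[OF h(1)] x(2) by blast
    then show ?thesis using act(5)[OF h(1), of b] by (metis imageI)
  qed
  moreover have "aligned_set (h ` A)"
    using A h by (auto simp: max_aligned_def aligned_set_def aligned_act)
  ultimately have "h ` A = B" using B unfolding max_aligned_def by blast
  then show ?thesis using that h by blast
qed

end

section \<open>The span of a maximal aligned set as a section\<close>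

locale fundamental_cone = pd_group +
  fixes A :: "'a set"
  assumes maxA: "max_aligned A"
begin

abbreviation "\<Sigma> \<equiv> span A"
abbreviation "W \<equiv> weyl G \<Sigma>"

lemma alA: "aligned_set A"
  using maxA by (simp add: max_aligned_def)

lemma A_Sigma: "a \<in> A \<Longrightarrow> a \<in> \<Sigma>"
  by (rule span_base)

lemma W_G: "w \<in> W \<Longrightarrow> w \<in> G" and W_Sigma: "w \<in> W \<Longrightarrow> u \<in> \<Sigma> \<Longrightarrow> w u \<in> \<Sigma>"
  unfolding weyl_def by auto

lemma id_W: "id \<in> W"
  using id_mem by (simp add: weyl_def)

lemma comp_W: "w \<in> W \<Longrightarrow> v \<in> W \<Longrightarrow> w \<circ> v \<in> W"
  using comp_mem[of w v] image_comp[of w v \<Sigma>] by (simp add: weyl_def)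

lemma inv_W: "w \<in> W \<Longrightarrow> inv w \<in> W"
proof -
  assume w: "w \<in> W"
  then have "inv w ` \<Sigma> = inv w ` (w ` \<Sigma>)" by (simp add: weyl_def)
  also have "\<dots> = \<Sigma>" using act(4)[OF W_G[OF w]] by (simp add: image_image)
  finally show ?thesis using act(6)[OF W_G[OF w]] by (simp add: weyl_def)
qed

lemma unique_A: "a \<in> A \<Longrightarrow> g \<in> G \<Longrightarrow> g a \<in> A \<Longrightarrow> g a = a"
  by (rule max_aligned_unique[OF maxA])

lemma A_meets: "\<exists>g\<in>G. \<exists>a\<in>A. z = g a"
proof -
  obtain g where g: "g \<in> G" "g z \<in> A" using max_aligned_meets_orbit[OF maxA] by blast
  then show ?thesis using act(4,6)[OF g(1)] by metis
qed

text \<open>Enlarge \<open>F\<close> to a finite aligned set in \<open>\<Sigma>\<close> of largest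
  dimension. Small steps from its sum stay aligned with it, so it already spans
  \<open>\<Sigma>\<close>. A maximal aligned set containing it is a translate of \<open>A\<close> by
  some \<open>h\<close>, and comparing dimensions shows that \<open>h\<close> preserves
  \<open>\<Sigma>\<close>.\<close>

lemma aligned_in_chamber:
  assumes F: "finite F" "aligned_set F" "F \<subseteq> \<Sigma>"
  obtains w where "w \<in> W" "F \<subseteq> w ` A"
proof -
  define P where "P E \<longleftrightarrow> finite E \<and> aligned_set E \<and> E \<subseteq> \<Sigma> \<and> F \<subseteq> E" for E
  have "P F" using F by (simp add: P_def)
  moreover have "\<forall>E. P E \<longrightarrow> dim E < Suc (DIM('a))" using dim_subset_UNIV by (auto simp: less_Suc_eq_le)
  ultimately obtain E where E: "P E" and max: "\<And>E'. P E' \<Longrightarrow> dim E' \<le> dim E"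
    using ex_has_greatest_nat[of P F dim "Suc (DIM('a))"] by blast
  have Ef: "finite E" "aligned_set E" "E \<subseteq> \<Sigma>" "F \<subseteq> E" using E by (simp_all add: P_def)
  define u where "u = \<Sum>E"
  have uE: "u \<in> span E" unfolding u_def by (intro span_sum span_base)
  have uS: "u \<in> \<Sigma>" using uE Ef(3) span_minimal[OF Ef(3)] subspace_span by blast
  have "s \<in> span E" if s: "s \<in> \<Sigma>" for s
  proof -
    obtain t where t: "t > 0" "aligned u (u + t *\<^sub>R s)" using aligned_small_step[OF alA uS s] by blast
    define u' where "u' = u + t *\<^sub>R s"
    have "\<forall>f\<in>E. aligned f u'" using t aligned_sum_iff[OF Ef(1,2)] by (simp add: u_def u'_def)
    then have "P (insert u' E)"
      using Ef aligned_set_insert[OF Ef(2), of u'] uS s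
      by (auto simp: P_def u'_def intro: span_add span_scale)
    then have "dim (insert u' E) \<le> dim E" by (rule max)
    then have "u' \<in> span E" by (simp add: dim_insert split: if_splits)
    then have "u' - u \<in> span E" using uE by (rule span_diff)
    then have "(1 / t) *\<^sub>R (u' - u) \<in> span E" by (rule span_scale)
    then show ?thesis using t by (simp add: u'_def)
  qed
  then have SE: "\<Sigma> \<subseteq> span E" by blast
  obtain B where B: "max_aligned B" "E \<subseteq> B" using max_aligned_extend[OF Ef(2)] by blast
  obtain h where h: "h \<in> G" "B = h ` A" using max_aligned_conjugate[OF maxA B(1)] by blast
  have lin: "linear h" by (rule act(1)[OF h(1)])
  have inj: "inj h" using act(8)[OF h(1)] by (rule bij_is_inj)
  have "\<Sigma> \<subseteq> h ` \<Sigma>" using SE span_mono[OF B(2)] linear_span_image[OF lin, of A] h by auto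
  moreover have "dim (h ` \<Sigma>) = dim \<Sigma>" using lin inj by (intro dim_image_eq) (auto intro: inj_on_subset)
  ultimately have "\<Sigma> = h ` \<Sigma>"
    by (intro subspace_dim_equal) (simp_all add: linear_subspace_image lin)
  then have "h \<in> W" using h by (simp add: weyl_def)
  then show ?thesis using that B Ef h by blast
qed

lemma Sigma_cover: "y \<in> \<Sigma> \<Longrightarrow> \<exists>w\<in>W. \<exists>a\<in>A. y = w a"
proof -
  assume "y \<in> \<Sigma>"
  then obtain w where "w \<in> W" "{y} \<subseteq> w ` A"
    using aligned_in_chamber[of "{y}"] aligned_self by (auto simp: aligned_set_def)
  then show ?thesis by blast
qed

text \<open>Weyl elements carry both \<open>y\<close> and \<open>g y\<close> back into
  \<open>A\<close>. The resulting points share an orbit, so they coincide.\<close>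

lemma orb_W: "y \<in> \<Sigma> \<Longrightarrow> orb W y = orb G y \<inter> \<Sigma>"
proof -
  assume y: "y \<in> \<Sigma>"
  have "g y \<in> orb W y" if g: "g \<in> G" "g y \<in> \<Sigma>" for g
  proof -
    obtain w a where w: "w \<in> W" "a \<in> A" "y = w a" using Sigma_cover[OF y] by blast
    obtain v b where v: "v \<in> W" "b \<in> A" "g y = v b" using Sigma_cover[OF g(2)] by blast
    have "b = (inv v \<circ> g \<circ> w) a" using v w act(4)[OF W_G[OF v(1)], of b] by simp
    moreover have "inv v \<circ> g \<circ> w \<in> G" by (intro comp_mem act(6) W_G v w g)
    ultimately have "b = a" using unique_A[OF w(2), of "inv v \<circ> g \<circ> w"] v(2) by simp
    then have "g y = (v \<circ> inv w) y" using v w act(4)[OF W_G[OF w(1)]] by simp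
    moreover have "v \<circ> inv w \<in> W" by (intro comp_W inv_W v w)
    ultimately show ?thesis unfolding orb_def by blast
  qed
  moreover have "orb W y \<subseteq> orb G y \<inter> \<Sigma>" using W_G W_Sigma y by (auto simp: orb_def)
  ultimately show ?thesis by (auto simp: orb_def)
qed

lemma section_Sigma: "is_section G \<Sigma>"
  unfolding is_section_def
proof (intro conjI ballI)
  show "subspace \<Sigma>" by simp
  show "(\<Union>g\<in>G. g ` \<Sigma>) = UNIV"
  proof -
    have "z \<in> (\<Union>g\<in>G. g ` \<Sigma>)" for z using A_meets[of z] A_Sigma by blast
    then show ?thesis by blast
  qed
  show "orthogonal v s" if "x \<in> \<Sigma>" "v \<in> tangent_space (orb G x) x" "s \<in> \<Sigma>" for x v s
    by (rule tangent_orthogonal_span[OF alA that(1,3,2)])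
qed

lemma dist_A:
  assumes "a \<in> A" "b \<in> A" "g \<in> G" "h \<in> G"
  shows "dist a b \<le> dist (g a) (h b)"
proof -
  have "g a \<bullet> h b \<le> a \<bullet> b"
    using mf_ge[OF assms(3,4), of a b] alA assms(1,2) by (simp add: aligned_set_def aligned_def)
  then have "(dist a b)\<^sup>2 \<le> (dist (g a) (h b))\<^sup>2"
    using act(2)[OF assms(3), of a a] act(2)[OF assms(4), of b b]
    by (simp add: dist_norm power2_norm_eq_inner inner_diff_left inner_diff_right inner_commute)
  then show ?thesis by (rule power2_le_imp_le) simp
qed

text \<open>The isometry sends an orbit to its trace on the section. The representatives in
  \<open>A\<close> lie in the orbit and in its trace and realize the distance in both
  quotients.\<close>

lemma quotient_isometry:
  "bij_betw (\<lambda>X. X \<inter> \<Sigma>) (range (orb G)) (orb W ` \<Sigma>) \<and>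
   (\<forall>X\<in>range (orb G). \<forall>Y\<in>range (orb G). qdist (X \<inter> \<Sigma>) (Y \<inter> \<Sigma>) = qdist X Y)"
proof -
  have rep: "\<exists>a\<in>A. X = orb G a" if "X \<in> range (orb G)" for X
  proof -
    obtain z where "X = orb G z" using \<open>X \<in> range (orb G)\<close> by blast
    moreover obtain g a where "g \<in> G" "a \<in> A" "z = g a" using A_meets by blast
    ultimately show ?thesis using orb_act by blast
  qed
  have "inj_on (\<lambda>X. X \<inter> \<Sigma>) (range (orb G))"
  proof (rule inj_onI)
    fix X Y assume X: "X \<in> range (orb G)" and Y: "Y \<in> range (orb G)" and e: "X \<inter> \<Sigma> = Y \<inter> \<Sigma>"
    obtain a b where a: "a \<in> A" "X = orb G a" and b: "b \<in> A" "Y = orb G b" using rep X Y by metis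
    have "a \<in> Y" using a e A_Sigma orb_self by blast
    then obtain g where "g \<in> G" "a = g b" using b by (auto simp: orb_def)
    then show "X = Y" using a b orb_act by simp
  qed
  moreover have "(\<lambda>X. X \<inter> \<Sigma>) ` range (orb G) = orb W ` \<Sigma>"
  proof
    show "(\<lambda>X. X \<inter> \<Sigma>) ` range (orb G) \<subseteq> orb W ` \<Sigma>"
    proof
      fix Z assume "Z \<in> (\<lambda>X. X \<inter> \<Sigma>) ` range (orb G)"
      then obtain a where "a \<in> A" "Z = orb G a \<inter> \<Sigma>" using rep by blast
      then show "Z \<in> orb W ` \<Sigma>" using orb_W[of a] A_Sigma[of a] by blast
    qed
    show "orb W ` \<Sigma> \<subseteq> (\<lambda>X. X \<inter> \<Sigma>) ` range (orb G)" using orb_W by blast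
  qed
  moreover have "qdist (X \<inter> \<Sigma>) (Y \<inter> \<Sigma>) = qdist X Y"
    if X: "X \<in> range (orb G)" and Y: "Y \<in> range (orb G)" for X Y
  proof -
    obtain a b where a: "a \<in> A" "X = orb G a" and b: "b \<in> A" "Y = orb G b" using rep X Y by metis
    have le: "dist a b \<le> dist p q" if "p \<in> X" "q \<in> Y" for p q
      using that a b dist_A by (auto simp: orb_def)
    have "a \<in> X" "b \<in> Y" "a \<in> \<Sigma>" "b \<in> \<Sigma>" using a b orb_self A_Sigma by auto
    then have "qdist X Y = dist a b" "qdist (X \<inter> \<Sigma>) (Y \<inter> \<Sigma>) = dist a b"
      using le by (auto intro!: qdist_eqI)
    then show ?thesis by simp
  qed
  ultimately show ?thesis unfolding bij_betw_def by blast
qed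

end

subsection \<open>The Weyl group of the section\<close>

context fundamental_cone
begin

text \<open>Fixing a regular point, \<open>g\<close> preserves alignment with it and so maps
  \<open>A\<close> into itself. Uniqueness in orbits makes \<open>g\<close> the identity on
  \<open>A\<close>, and linearity extends this to the span.\<close>

lemma regular_fixed:
  assumes x: "x \<in> A" "\<And>u. aligned x u \<Longrightarrow> u \<in> A" and g: "g \<in> G" "g x = x" and u: "u \<in> \<Sigma>"
  shows "g u = u"
proof -
  have "g a = id a" if a: "a \<in> A" for a
  proof -
    have "aligned x a" using alA x(1) a by (simp add: aligned_set_def)
    then have "aligned (g x) (g a)" using aligned_act[OF g(1)] by blast
    then have "g a \<in> A" using x(2) g by simp
    then show ?thesis using unique_A[OF a g(1)] by simp
  qed
  then have "g u = id u" by (rule linear_eq_on_span[OF act(1)[OF g(1)] linear_id _ u])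
  then show ?thesis by simp
qed

lemma W_regular_eq:
  assumes x: "x \<in> A" "\<And>u. aligned x u \<Longrightarrow> u \<in> A" and wv: "w \<in> W" "v \<in> W" "w x = v x" and u: "u \<in> \<Sigma>"
  shows "w u = v u"
proof -
  have "inv v \<circ> w \<in> G" by (intro comp_mem act(6) W_G wv)
  moreover have "(inv v \<circ> w) x = x" using wv act(4)[OF W_G[OF wv(2)]] by simp
  ultimately have "(inv v \<circ> w) u = u" using regular_fixed[OF x] u by blast
  then show ?thesis using act(5)[OF W_G[OF wv(2)], of "w u"] by simp
qed

text \<open>The displacement \<open>d = w x - x\<close> lies in \<open>\<Sigma>\<close> itself, so
  all its coordinates in an orthonormal basis of \<open>\<Sigma>\<close> are of second order in
  \<open>d\<close>. A nonzero \<open>d\<close> of this kind cannot be small.\<close>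

lemma W_orbit_discrete:
  assumes x: "x \<in> \<Sigma>"
  shows "\<exists>e>0. \<forall>w\<in>W. w x \<noteq> x \<longrightarrow> e \<le> norm (w x - x)"
proof -
  obtain B where B: "B \<subseteq> \<Sigma>" "pairwise orthogonal B" "\<And>b. b \<in> B \<Longrightarrow> norm b = 1" "independent B" "span B = \<Sigma>"
    using orthonormal_basis_subspace[OF subspace_span, of A] by metis
  have fin: "finite B" using B(4) by (rule independent_imp_finite)
  have "\<forall>b\<in>B. \<exists>C\<ge>0. \<forall>g\<in>G. \<bar>(g x - x) \<bullet> b\<bar> \<le> C * (norm (g x - x))\<^sup>2"
    using aligned_span_quadratic[OF alA x] B(1) by blast
  from bchoice[OF this]
  obtain C where C: "\<forall>b\<in>B. C b \<ge> 0 \<and> (\<forall>g\<in>G. \<bar>(g x - x) \<bullet> b\<bar> \<le> C b * (norm (g x - x))\<^sup>2)"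
    by (rule exE)
  \<comment> \<open>The \<open>+ 1\<close> makes \<open>K\<close> positive even if all the constants
    vanish.\<close>
  define K where "K = (\<Sum>b\<in>B. C b) + 1"
  have K: "K > 0" using C by (auto simp: K_def intro!: add_nonneg_pos sum_nonneg)
  have "1 / K \<le> norm (w x - x)" if w: "w \<in> W" "w x \<noteq> x" for w
  proof -
    define d where "d = w x - x"
    have d0: "norm d > 0" using w by (simp add: d_def)
    have "d \<in> span B" using W_Sigma[OF w(1) x] x B(5) by (simp add: d_def span_diff)
    then have deq: "d = (\<Sum>b\<in>B. (d \<bullet> b) *\<^sub>R b)"
      using orthonormal_basis_expand[OF B(2,3) _ fin] by simp
    have "(norm d)\<^sup>2 = d \<bullet> (\<Sum>b\<in>B. (d \<bullet> b) *\<^sub>R b)" using deq by (simp add: power2_norm_eq_inner)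
    also have "\<dots> = (\<Sum>b\<in>B. (d \<bullet> b) * (d \<bullet> b))" by (simp add: inner_sum_right)
    also have "\<dots> \<le> (\<Sum>b\<in>B. norm d * (C b * (norm d)\<^sup>2))"
    proof (rule sum_mono)
      fix b assume b: "b \<in> B"
      have "(d \<bullet> b) * (d \<bullet> b) = \<bar>d \<bullet> b\<bar> * \<bar>d \<bullet> b\<bar>" by simp
      also have "\<dots> \<le> norm d * (C b * (norm d)\<^sup>2)"
        using Cauchy_Schwarz_ineq2[of d b] B(3)[OF b] C b W_G[OF w(1)]
        by (intro mult_mono) (auto simp: d_def)
      finally show "(d \<bullet> b) * (d \<bullet> b) \<le> norm d * (C b * (norm d)\<^sup>2)" .
    qed
    also have "\<dots> = norm d * (\<Sum>b\<in>B. C b) * (norm d)\<^sup>2"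
      by (simp add: sum_distrib_left sum_distrib_right mult.assoc)
    finally have "1 \<le> norm d * (\<Sum>b\<in>B. C b)" using d0 by (simp add: mult_le_cancel_right1)
    moreover have "norm d * K = norm d * (\<Sum>b\<in>B. C b) + norm d" by (simp add: K_def distrib_left)
    ultimately have "1 \<le> norm d * K" using d0 by linarith
    then show ?thesis using K by (simp add: d_def pos_divide_le_eq)
  qed
  then show ?thesis using K by (intro exI[of _ "1 / K"]) auto
qed

text \<open>As \<open>W\<close> acts transitively by isometries, the gap at \<open>x\<close>
  separates all points of the orbit uniformly. An infinite bounded orbit would have a limit
  point.\<close>

lemma finite_W_orbit: "x \<in> \<Sigma> \<Longrightarrow> finite (orb W x)"
proof (rule ccontr)
  assume x: "x \<in> \<Sigma>" and inf: "infinite (orb W x)"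
  obtain e where e: "e > 0" "\<forall>w\<in>W. w x \<noteq> x \<longrightarrow> e \<le> norm (w x - x)"
    using W_orbit_discrete[OF x] by blast
  have sep: "e \<le> dist p q" if pq: "p \<in> orb W x" "q \<in> orb W x" "p \<noteq> q" for p q
  proof -
    obtain w v where w: "w \<in> W" "p = w x" and v: "v \<in> W" "q = v x" using pq by (auto simp: orb_def)
    have "(inv v \<circ> w) x \<noteq> x"
    proof
      assume "(inv v \<circ> w) x = x"
      then have "v (inv v (w x)) = v x" by simp
      then show False using act(5)[OF W_G[OF v(1)]] w v pq by simp
    qed
    moreover have "inv v \<circ> w \<in> W" by (intro comp_W inv_W v w)
    ultimately have "e \<le> norm ((inv v \<circ> w) x - x)" using e by blast
    also have "\<dots> = norm (v ((inv v \<circ> w) x - x))" using act(3)[OF W_G[OF v(1)]] by simp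
    also have "v ((inv v \<circ> w) x - x) = p - q"
      using act(5)[OF W_G[OF v(1)]] linear_diff[OF act(1)[OF W_G[OF v(1)]]] w v by simp
    finally show ?thesis by (simp add: dist_norm)
  qed
  have "orb W x \<subseteq> cball 0 (norm x)" using act(3)[OF W_G] by (auto simp: orb_def)
  then obtain l where l: "l islimpt orb W x"
    using Heine_Borel_imp_Bolzano_Weierstrass[OF compact_cball inf] by blast
  then have "infinite (orb W x \<inter> ball l (e / 2))" using e by (simp add: islimpt_eq_infinite_ball)
  then obtain p where p: "p \<in> orb W x \<inter> ball l (e / 2)"
    and inf': "infinite (orb W x \<inter> ball l (e / 2) - {p})"
    by (metis finite.emptyI infinite_remove ex_in_conv)
  then obtain q where "q \<in> orb W x \<inter> ball l (e / 2) - {p}" by (metis finite.emptyI ex_in_conv)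
  then show False using p sep[of p q] dist_triangle_half_r[of l p e q] by (auto simp: dist_commute)
qed

abbreviation "R \<equiv> (\<lambda>g. restrict g \<Sigma>) ` W"

text \<open>The action of a Weyl element on the section is determined by the image of one regular
  point, which has a finite orbit.\<close>

lemma finite_R: "finite R"
proof -
  obtain x where x: "x \<in> A" "\<And>u. aligned x u \<Longrightarrow> u \<in> A" using regular_point_exists[OF maxA] by blast
  have "inj_on (\<lambda>f. f x) R"
  proof (rule inj_onI)
    fix f f' assume f: "f \<in> R" and f': "f' \<in> R" and e: "f x = f' x"
    obtain w v where w: "w \<in> W" "f = restrict w \<Sigma>" and v: "v \<in> W" "f' = restrict v \<Sigma>" using f f' by blast
    have "w x = v x" using e w v A_Sigma[OF x(1)] by simp
    then have "\<And>u. u \<in> \<Sigma> \<Longrightarrow> w u = v u" using W_regular_eq[OF x w(1) v(1)] by blast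
    then show "f = f'" using w v by (auto simp: restrict_def)
  qed
  moreover have "(\<lambda>f. f x) ` R \<subseteq> orb W x" using A_Sigma[OF x(1)] by (auto simp: orb_def)
  ultimately show ?thesis using finite_W_orbit[OF A_Sigma[OF x(1)]] by (rule inj_on_finite)
qed

text \<open>\<open>A\<close> is the Dirichlet domain of a regular point. If \<open>u = w a\<close>
  with \<open>a\<close> in \<open>A\<close>, then \<open>mf x u\<close> equals
  \<open>w x \<bullet> u\<close>, so the inequality for this one \<open>w\<close> already makes
  \<open>u\<close> aligned with \<open>x\<close>.\<close>

lemma A_polyhedral:
  assumes x: "x \<in> A" "\<And>u. aligned x u \<Longrightarrow> u \<in> A"
  shows "A = {u \<in> \<Sigma>. \<forall>v\<in>{x - w x |w. w \<in> W \<and> w x \<noteq> x}. 0 \<le> u \<bullet> v}"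
proof
  show "A \<subseteq> {u \<in> \<Sigma>. \<forall>v\<in>{x - w x |w. w \<in> W \<and> w x \<noteq> x}. 0 \<le> u \<bullet> v}"
  proof
    fix u assume u: "u \<in> A"
    then have "aligned x u" using alA x(1) by (simp add: aligned_set_def)
    then have "0 \<le> u \<bullet> (x - w x)" if "w \<in> W" for w
      using W_G[OF that] by (simp add: aligned_iff inner_diff_right inner_commute)
    then show "u \<in> {u \<in> \<Sigma>. \<forall>v\<in>{x - w x |w. w \<in> W \<and> w x \<noteq> x}. 0 \<le> u \<bullet> v}" using A_Sigma[OF u] by auto
  qed
  show "{u \<in> \<Sigma>. \<forall>v\<in>{x - w x |w. w \<in> W \<and> w x \<noteq> x}. 0 \<le> u \<bullet> v} \<subseteq> A"
  proof
    fix u assume u: "u \<in> {u \<in> \<Sigma>. \<forall>v\<in>{x - w x |w. w \<in> W \<and> w x \<noteq> x}. 0 \<le> u \<bullet> v}"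
    then obtain w a where w: "w \<in> W" "a \<in> A" "u = w a" using Sigma_cover by blast
    have "mf x u = mf x a" using w by (simp add: mf_act W_G)
    also have "\<dots> = x \<bullet> a" using alA x(1) w by (simp add: aligned_set_def aligned_def)
    also have "\<dots> = w x \<bullet> u" using w act(2)[OF W_G[OF w(1)]] by simp
    also have "\<dots> \<le> x \<bullet> u"
    proof (cases "w x = x")
      case False
      then have "0 \<le> u \<bullet> (x - w x)" using u w by blast
      then show ?thesis by (simp add: inner_diff_right inner_commute)
    qed simp
    finally have "aligned x u" using mf_ge_inner[of x u] by (simp add: aligned_def)
    then show "u \<in> A" by (rule x(2))
  qed
qed

text \<open>Cross the wall at the interior facet point \<open>p\<close> to a nearby \<open>q\<close>
  aligned with \<open>p\<close>. Some Weyl element \<open>w\<close> puts both into one translate of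
  \<open>A\<close>, and uniqueness makes it fix \<open>p\<close>. Near \<open>p\<close>,
  \<open>A\<close> and its translate look like half-spaces with normals \<open>v\<close> and
  \<open>w v\<close>. As \<open>w\<close> fixes directions common to both, either \<open>w\<close>
  is trivial, which \<open>q\<close> rules out, or \<open>w v = - v\<close>.\<close>

lemma wall_reflection:
  assumes A: "\<And>u. u \<in> A \<longleftrightarrow> u \<in> \<Sigma> \<and> (\<forall>v\<in>N. 0 \<le> u \<bullet> v)" and fin: "finite N"
    and v: "v \<in> N" "v \<in> \<Sigma>" "v \<noteq> 0"
    and p: "p \<in> \<Sigma>" "p \<bullet> v = 0" "\<And>v'. v' \<in> N - {v} \<Longrightarrow> p \<bullet> v' > 0"
  shows "\<exists>w\<in>W. \<forall>u\<in>\<Sigma>. w u = hrefl v u"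
proof -
  have near: "\<exists>e>0. \<forall>t. 0 \<le> t \<and> t \<le> e \<longrightarrow> p + t *\<^sub>R d \<in> A" if d: "d \<in> \<Sigma>" "d \<bullet> v \<ge> 0" for d
  proof -
    obtain e where e: "e > 0" "\<forall>v'\<in>N - {v}. \<forall>t. 0 \<le> t \<and> t \<le> e \<longrightarrow> (p + t *\<^sub>R d) \<bullet> v' > 0"
      using small_perturbation[of "N - {v}" p d] fin p(3) by blast
    have "p + t *\<^sub>R d \<in> A" if t: "0 \<le> t" "t \<le> e" for t
    proof -
      have "0 \<le> (p + t *\<^sub>R d) \<bullet> v'" if v': "v' \<in> N" for v'
      proof (cases "v' = v")
        case True
        then show ?thesis using p d t by (simp add: inner_add_left)
      next
        case False
        then show ?thesis using e(2) v' t by (auto intro: less_imp_le)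
      qed
      moreover have "p + t *\<^sub>R d \<in> \<Sigma>" using p d by (intro span_add span_scale)
      ultimately show ?thesis using A by blast
    qed
    then show ?thesis using e by blast
  qed
  have pA: "p \<in> A" using near[of 0] by (auto simp: span_zero)
  have mv: "- v \<in> \<Sigma>" using v by (simp add: span_neg)
  obtain s where s: "s > 0" "aligned p (p + s *\<^sub>R (- v))" using aligned_small_step[OF alA p(1) mv] by blast
  define q where "q = p - s *\<^sub>R v"
  have qS: "q \<in> \<Sigma>" using p v by (simp add: q_def span_diff span_scale)
  have "aligned_set {p, q}"
    using s aligned_self aligned_commute[of q p] by (auto simp: aligned_set_def q_def)
  then obtain w where w: "w \<in> W" "{p, q} \<subseteq> w ` A"
    using aligned_in_chamber[of "{p, q}"] p qS by auto
  obtain a b where a: "a \<in> A" "p = w a" and b: "b \<in> A" "q = w b" using w by auto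
  have "a = p" using unique_A[of a w] a pA W_G[OF w(1)] by simp
  then have wp: "w p = p" using a by simp
  have lin: "linear w" by (rule act(1)[OF W_G[OF w(1)]])
  have qA: "q \<notin> A"
  proof
    assume "q \<in> A"
    then have "0 \<le> q \<bullet> v" using v A by blast
    then have "s * (v \<bullet> v) \<le> 0" by (simp add: q_def inner_diff_left p)
    then show False using s v by (metis inner_gt_zero_iff mult_pos_pos not_le)
  qed
  \<comment> \<open>Short steps from \<open>p\<close> along \<open>d\<close> and along
    \<open>inv w d\<close> both end in \<open>A\<close>, and \<open>w\<close> maps the second end
    point to the first, so they are equal.\<close>
  have fixed: "w d = d" if d: "d \<in> \<Sigma>" "d \<bullet> v \<ge> 0" "d \<bullet> w v \<ge> 0" for d
  proof -
    define d' where "d' = inv w d"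
    have d': "d' \<in> \<Sigma>" "d' \<bullet> v \<ge> 0" "w d' = d"
      using W_Sigma[OF inv_W[OF w(1)] d(1)] d(3) act(5,7)[OF W_G[OF w(1)]]
      by (simp_all add: d'_def inner_commute)
    obtain e1 where e1: "e1 > 0" "\<forall>t. 0 \<le> t \<and> t \<le> e1 \<longrightarrow> p + t *\<^sub>R d \<in> A" using near[OF d(1,2)] by blast
    obtain e2 where e2: "e2 > 0" "\<forall>t. 0 \<le> t \<and> t \<le> e2 \<longrightarrow> p + t *\<^sub>R d' \<in> A" using near[OF d'(1,2)] by blast
    define t where "t = min e1 e2"
    have t: "t > 0" "p + t *\<^sub>R d \<in> A" "p + t *\<^sub>R d' \<in> A" using e1 e2 by (auto simp: t_def)
    have wt: "w (p + t *\<^sub>R d') = p + t *\<^sub>R d" using lin wp d' by (simp add: linear_add linear_scale)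
    then have "p + t *\<^sub>R d = p + t *\<^sub>R d'" using unique_A[OF t(3) W_G[OF w(1)]] t(2) by simp
    then have "d = d'" using t by simp
    then show ?thesis using d' by simp
  qed
  have wv: "w v = - v"
  proof (rule ccontr)
    assume neq: "w v \<noteq> - v"
    \<comment> \<open>Since \<open>v\<close> and \<open>w v\<close> have equal length, their sum has
      equal positive inner product with both. It is therefore interior to the two half-spaces, and
      the directions near it span the section.\<close>
    define d where "d = v + w v"
    have d0: "d \<bullet> d > 0" using neq by (simp add: d_def add_eq_0_iff)
    have "w v \<bullet> w v = v \<bullet> v" by (rule act(2)[OF W_G[OF w(1)]])
    then have dd: "d \<bullet> v = d \<bullet> d / 2" "d \<bullet> w v = d \<bullet> d / 2"
      by (simp_all add: d_def inner_add_left inner_add_right inner_commute)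
    have dS: "d \<in> \<Sigma>" using v W_Sigma[OF w(1)] by (simp add: d_def span_add)
    have "w u = u" if u: "u \<in> \<Sigma>" for u
    proof -
      have pos: "d \<bullet> v' > 0" if "v' \<in> {v, w v}" for v' using that dd d0 by (metis half_gt_zero insertE singletonD)
      obtain e where e: "e > 0" "\<forall>v'\<in>{v, w v}. \<forall>t. 0 \<le> t \<and> t \<le> e \<longrightarrow> (d + t *\<^sub>R u) \<bullet> v' > 0"
        using small_perturbation[of "{v, w v}" d u] pos by blast
      then have e': "(d + e *\<^sub>R u) \<bullet> v \<ge> 0" "(d + e *\<^sub>R u) \<bullet> w v \<ge> 0" by (simp_all add: less_imp_le)
      have "w (d + e *\<^sub>R u) = d + e *\<^sub>R u"
        using dS u by (intro fixed e' span_add span_scale)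
      moreover have "w d = d" using dS pos by (intro fixed) (auto intro: less_imp_le)
      ultimately show ?thesis using e lin by (simp add: linear_add linear_scale)
    qed
    then have "q = b" using b A_Sigma by simp
    then show False using b qA by simp
  qed
  have "w u = hrefl v u" if u: "u \<in> \<Sigma>" for u
  proof -
    define c where "c = (u \<bullet> v) / (v \<bullet> v)"
    have "(u - c *\<^sub>R v) \<bullet> v = 0" using v by (simp add: c_def inner_diff_left)
    moreover have "u - c *\<^sub>R v \<in> \<Sigma>" using u v by (simp add: span_diff span_scale)
    ultimately have "w (u - c *\<^sub>R v) = u - c *\<^sub>R v" using wv by (intro fixed) auto
    then have "w u = u - c *\<^sub>R v + c *\<^sub>R w v" using lin by (simp add: linear_diff linear_scale algebra_simps)
    then show ?thesis by (simp add: wv hrefl_def c_def scaleR_2[symmetric] algebra_simps)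
  qed
  then show ?thesis using w by blast
qed

text \<open>The generators are the reflections in the walls of an irredundant description of
  \<open>A\<close>. If \<open>w x\<close> violates a wall inequality, that reflection increases its
  inner product with the regular point \<open>x\<close>. As the orbit is finite, this ends in
  \<open>A\<close>, where uniqueness and regularity leave only the identity.\<close>

lemma reflection_group_R: "finite_reflection_group_on \<Sigma> R"
proof -
  obtain x where x: "x \<in> A" "\<And>u. aligned x u \<Longrightarrow> u \<in> A" using regular_point_exists[OF maxA] by blast
  have xS: "x \<in> \<Sigma>" by (rule A_Sigma[OF x(1)])
  define N where "N = {x - w x |w. w \<in> W \<and> w x \<noteq> x}"
  have finO: "finite (orb W x)" by (rule finite_W_orbit[OF xS])
  have "N \<subseteq> (\<lambda>p. x - p) ` orb W x" by (auto simp: N_def orb_def)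
  then have finN: "finite N" using finO finite_surj by blast
  have NS: "v \<in> \<Sigma>" if "v \<in> N" for v using that xS W_Sigma by (auto simp: N_def intro!: span_diff)
  have Npos: "x \<bullet> v > 0" if v: "v \<in> N" for v
  proof -
    obtain w where w: "w \<in> W" "w x \<noteq> x" "v = x - w x" using v by (auto simp: N_def)
    have "v \<bullet> v = 2 * (x \<bullet> v)" using act(2)[OF W_G[OF w(1)], of x x]
      by (simp add: w(3) inner_diff_left inner_diff_right inner_commute)
    moreover have "v \<bullet> v > 0" using w by simp
    ultimately show ?thesis by simp
  qed
  obtain N' where N': "N' \<subseteq> N"
    and eq: "{u \<in> \<Sigma>. \<forall>v\<in>N'. 0 \<le> u \<bullet> v} = {u \<in> \<Sigma>. \<forall>v\<in>N. 0 \<le> u \<bullet> v}"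
    and fac: "\<And>v. v \<in> N' \<Longrightarrow> \<exists>p\<in>\<Sigma>. p \<bullet> v = 0 \<and> (\<forall>v'\<in>N' - {v}. p \<bullet> v' > 0)"
    using facet_points[OF subspace_span finN xS Npos] by blast
  have AN: "u \<in> A \<longleftrightarrow> u \<in> \<Sigma> \<and> (\<forall>v\<in>N'. 0 \<le> u \<bullet> v)" for u
    using arg_cong[OF A_polyhedral[OF x], of "\<lambda>X. u \<in> X"] arg_cong[OF eq, of "\<lambda>X. u \<in> X"]
    unfolding N_def mem_Collect_eq by (rule trans[OF _ sym])
  have wall: "\<exists>w\<in>W. \<forall>u\<in>\<Sigma>. w u = hrefl v u" if v: "v \<in> N'" for v
  proof -
    obtain p where "p \<in> \<Sigma>" "p \<bullet> v = 0" "\<forall>v'\<in>N' - {v}. p \<bullet> v' > 0" using fac[OF v] by blast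
    moreover have "v \<noteq> 0" using Npos[of v] v N' by auto
    ultimately show ?thesis
      using wall_reflection[OF AN _ v, of p] finite_subset[OF N' finN] NS N' v by blast
  qed
  define S where "S = (\<lambda>v. restrict (hrefl v) \<Sigma>) ` N'"
  have refl: "is_reflection_on \<Sigma> r" if r: "r \<in> S" for r
  proof -
    obtain v where v: "v \<in> N'" "r = restrict (hrefl v) \<Sigma>" using r by (auto simp: S_def)
    moreover have "v \<noteq> 0" using Npos[of v] v N' by auto
    ultimately show ?thesis using NS N' unfolding is_reflection_on_def
      by (intro bexI[of _ v]) (auto simp: hrefl_def restrict_def)
  qed
  have "f \<in> R" if "f \<in> generated_on \<Sigma> S" for f
    using that
  proof induction
    case gen_id
    show ?case using id_W by (rule imageI)
  next
    case (gen_step f s)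
    obtain w where w: "w \<in> W" "f = restrict w \<Sigma>" using gen_step by blast
    obtain v where v: "v \<in> N'" "s = restrict (hrefl v) \<Sigma>" using gen_step by (auto simp: S_def)
    obtain r where r: "r \<in> W" "\<forall>u\<in>\<Sigma>. r u = hrefl v u" using wall[OF v(1)] by blast
    have "restrict (s \<circ> f) \<Sigma> = restrict (r \<circ> w) \<Sigma>"
      using w v r W_Sigma[OF w(1)] by (auto simp: restrict_def)
    then show ?case using comp_W[OF r(1) w(1)] by blast
  qed
  moreover have "restrict w \<Sigma> \<in> generated_on \<Sigma> S" if "w \<in> W" for w
    using that
  \<comment> \<open>The measure counts the orbit points having larger inner product with
    \<open>x\<close>, equivalently those closer to \<open>x\<close>, than
    \<open>w x\<close>.\<close>
  proof (induction "card {p \<in> orb W x. x \<bullet> p > x \<bullet> w x}" arbitrary: w rule: less_induct)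
    case less
    note w = less.prems
    have wxS: "w x \<in> \<Sigma>" using W_Sigma[OF w xS] .
    show ?case
    proof (cases "w x \<in> A")
      case True
      then have "w x = id x" using unique_A[OF x(1) W_G[OF w]] by simp
      then have "\<And>u. u \<in> \<Sigma> \<Longrightarrow> w u = id u" using W_regular_eq[OF x w id_W] by blast
      then have "restrict w \<Sigma> = restrict id \<Sigma>" by (auto simp: restrict_def)
      then show ?thesis using generated_on.gen_id by metis
    next
      case False
      then obtain v where v: "v \<in> N'" "w x \<bullet> v < 0" using wxS AN[of "w x"] by (auto simp: not_le)
      obtain r where r: "r \<in> W" "\<forall>u\<in>\<Sigma>. r u = hrefl v u" using wall[OF v(1)] by blast
      have xv: "x \<bullet> v > 0" using Npos v N' by blast
      then have vv: "v \<bullet> v > 0" by auto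
      have rw: "r \<circ> w \<in> W" by (rule comp_W[OF r(1) w])
      have gt: "x \<bullet> (r \<circ> w) x > x \<bullet> w x"
        using r wxS xv vv v(2) by (simp add: hrefl_def inner_diff_right mult_neg_pos divide_neg_pos)
      have "card {p \<in> orb W x. x \<bullet> p > x \<bullet> (r \<circ> w) x} < card {p \<in> orb W x. x \<bullet> p > x \<bullet> w x}"
      proof (rule psubset_card_mono)
        have "(r \<circ> w) x \<in> orb W x" using rw unfolding orb_def by (rule imageI)
        then show "{p \<in> orb W x. x \<bullet> p > x \<bullet> (r \<circ> w) x} \<subset> {p \<in> orb W x. x \<bullet> p > x \<bullet> w x}"
          using gt by (intro psubsetI) auto
      qed (use finO in simp)
      then have "restrict (r \<circ> w) \<Sigma> \<in> generated_on \<Sigma> S" using less.hyps rw by blast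
      moreover have "restrict (hrefl v) \<Sigma> \<in> S" using v by (simp add: S_def)
      \<comment> \<open>Applying the same reflection a second time recovers \<open>w\<close> from
        \<open>r \<circ> w\<close>.\<close>
      ultimately have "restrict (restrict (hrefl v) \<Sigma> \<circ> restrict (r \<circ> w) \<Sigma>) \<Sigma> \<in> generated_on \<Sigma> S"
        by (rule generated_on.gen_step)
      also have "restrict (restrict (hrefl v) \<Sigma> \<circ> restrict (r \<circ> w) \<Sigma>) \<Sigma> = restrict w \<Sigma>"
        using r W_Sigma[OF w] W_Sigma[OF rw] by (auto simp: restrict_def)
      finally show ?thesis .
    qed
  qed
  ultimately have "R = generated_on \<Sigma> S" by blast
  then show ?thesis unfolding finite_reflection_group_on_def using finite_R refl by blast
qed

end

subsection \<open>Quotients by reflection groups\<close>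

lemma finite_attains_max:
  fixes f :: "'b \<Rightarrow> real"
  assumes "finite M" "M \<noteq> {}"
  obtains u where "u \<in> M" "\<And>v. v \<in> M \<Longrightarrow> f v \<le> f u"
proof -
  have "Max (f ` M) \<in> f ` M" using assms by (intro Max_in) auto
  then obtain u where "u \<in> M" "f u = Max (f ` M)" by auto
  then show ?thesis using that assms by (metis Max_ge finite_imageI imageI)
qed

text \<open>Among the maximizers of \<open>x \<bullet> u\<close> take one with the largest
  \<open>\<rho> \<bullet> u\<close>; ties occur when \<open>x\<close> lies on a wall. Reflecting in
  a violated root would give another maximizer with larger \<open>\<rho>\<close>-value, so this one
  is in the chamber and equals \<open>y\<close> by uniqueness.\<close>

lemma (in root_set) chamber_dominates:
  assumes fin: "finite (Y :: 'a set)" and y: "y \<in> Y" "y \<in> chamber" and x: "x \<in> chamber"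
    and closed: "\<And>a z. a \<in> \<Phi> \<Longrightarrow> z \<in> Y \<Longrightarrow> hrefl a z \<in> Y"
    and trans: "\<And>z. z \<in> Y \<Longrightarrow> \<exists>as. set as \<subseteq> \<Phi> \<and> z = refl_word as y"
    and z: "z \<in> Y"
  shows "x \<bullet> z \<le> x \<bullet> y"
proof -
  define M where "M = {u \<in> Y. \<forall>v\<in>Y. x \<bullet> v \<le> x \<bullet> u}"
  obtain u0 where "u0 \<in> Y" "\<And>v. v \<in> Y \<Longrightarrow> x \<bullet> v \<le> x \<bullet> u0"
    using finite_attains_max[OF fin, of "\<lambda>u. x \<bullet> u"] y(1) by blast
  then have "M \<noteq> {}" unfolding M_def by blast
  moreover have "finite M" using fin by (simp add: M_def)
  ultimately obtain u where u: "u \<in> M" "\<And>v. v \<in> M \<Longrightarrow> \<rho> \<bullet> v \<le> \<rho> \<bullet> u"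
    using finite_attains_max[of M "\<lambda>u. \<rho> \<bullet> u"] by blast
  have uY: "u \<in> Y" and umax: "\<And>v. v \<in> Y \<Longrightarrow> x \<bullet> v \<le> x \<bullet> u" using u by (auto simp: M_def)
  have "u \<in> chamber"
  proof (rule ccontr)
    assume "u \<notin> chamber"
    then obtain a where a: "a \<in> pos" "u \<bullet> a < 0" by (auto simp: chamber_def not_le)
    then have a': "a \<in> \<Phi>" "\<rho> \<bullet> a > 0" "x \<bullet> a \<ge> 0" using x by (auto simp: pos_def chamber_def)
    have aa: "a \<bullet> a = 1" using norm_roots[OF a'(1)] by (simp add: dot_square_norm)
    have rY: "hrefl a u \<in> Y" by (rule closed[OF a'(1) uY])
    have in_eq: "c \<bullet> hrefl a u = c \<bullet> u - 2 * (u \<bullet> a) * (c \<bullet> a)" for c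
      by (simp add: hrefl_def aa inner_diff_right)
    have "(u \<bullet> a) * (x \<bullet> a) \<le> 0" using a a' by (simp add: mult_nonpos_nonneg)
    then have "x \<bullet> u \<le> x \<bullet> hrefl a u" by (simp add: in_eq)
    then have "hrefl a u \<in> M" using rY umax unfolding M_def by force
    then have "\<rho> \<bullet> hrefl a u \<le> \<rho> \<bullet> u" by (rule u(2))
    moreover have "(u \<bullet> a) * (\<rho> \<bullet> a) < 0" using a a' by (simp add: mult_neg_pos)
    ultimately show False by (simp add: in_eq mult.commute)
  qed
  moreover obtain as where "set as \<subseteq> \<Phi>" "u = refl_word as y" using trans[OF uY] by blast
  ultimately have "u = y" using chamber_unique y(2) by blast
  then show ?thesis using umax[OF z] by simp
qed

text \<open>The embedding sends each orbit to its representative in the closed chamber. Chamber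
  representatives maximize the inner product over their orbits and hence realize the quotient
  distance.\<close>

lemma reflection_quotient_embedding:
  fixes G :: "('a::euclidean_space \<Rightarrow> 'a) set"
  assumes grp: "orth_group G" and S: "subspace \<Sigma>"
    and R: "finite_reflection_group_on \<Sigma> ((\<lambda>g. restrict g \<Sigma>) ` weyl G \<Sigma>)"
  shows "\<exists>\<phi>. \<forall>X\<in>orb (weyl G \<Sigma>) ` \<Sigma>. \<forall>Y\<in>orb (weyl G \<Sigma>) ` \<Sigma>. qdist X Y = dist (\<phi> X) (\<phi> Y :: 'a)"
proof -
  let ?W = "weyl G \<Sigma>" let ?R = "(\<lambda>g. restrict g \<Sigma>) ` ?W"
  obtain T where T: "\<And>r. r \<in> T \<Longrightarrow> is_reflection_on \<Sigma> r" and RT: "?R = generated_on \<Sigma> T" and finR: "finite ?R"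
    using R unfolding finite_reflection_group_on_def by blast
  note act = orth_group_simps[OF grp]
  have WG: "w \<in> G" and WS: "\<And>u. u \<in> \<Sigma> \<Longrightarrow> w u \<in> \<Sigma>" if "w \<in> ?W" for w using that by (auto simp: weyl_def)
  have idW: "id \<in> ?W" using grp by (simp add: weyl_def orth_group_def)
  have compW: "w \<circ> v \<in> ?W" if "w \<in> ?W" "v \<in> ?W" for w v
    using that grp image_comp[of w v \<Sigma>] by (simp add: weyl_def orth_group_def)
  have invW: "inv w \<in> ?W" if w: "w \<in> ?W" for w
  proof -
    have "inv w ` \<Sigma> = inv w ` (w ` \<Sigma>)" using w by (simp add: weyl_def)
    also have "\<dots> = \<Sigma>" using act(4)[OF WG[OF w]] by (simp add: image_image)
    finally show ?thesis using act(6)[OF WG[OF w]] by (simp add: weyl_def)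
  qed
  \<comment> \<open>All unit normals of reflections occurring in the group are collected, not only
    those of the generators; this makes the set closed under its own reflections.\<close>
  define \<Phi> where "\<Phi> = {v \<in> \<Sigma>. norm v = 1 \<and> (\<exists>w\<in>?W. \<forall>u\<in>\<Sigma>. w u = hrefl v u)}"
  have fin\<Phi>: "finite \<Phi>"
  proof -
    have sub: "\<Phi> \<subseteq> (\<Union>r\<in>?R. {v \<in> \<Sigma>. norm v = 1 \<and> (\<forall>u\<in>\<Sigma>. r u = hrefl v u)})"
      unfolding \<Phi>_def by force
    \<comment> \<open>A reflection determines its unit normal up to sign.\<close>
    have fin: "finite {v \<in> \<Sigma>. norm v = 1 \<and> (\<forall>u\<in>\<Sigma>. r u = hrefl v u)}" for r
    proof (cases "{v \<in> \<Sigma>. norm v = 1 \<and> (\<forall>u\<in>\<Sigma>. r u = hrefl v u)} = {}")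
      case False
      then obtain a where a: "a \<in> \<Sigma>" "norm a = 1" "\<forall>u\<in>\<Sigma>. r u = hrefl a u" by blast
      have "v \<in> {a, - a}" if v: "v \<in> \<Sigma>" "norm v = 1" "\<forall>u\<in>\<Sigma>. r u = hrefl v u" for v
      proof -
        have "hrefl v a = - a" using a v by (metis hrefl_self)
        moreover have "v \<bullet> v = 1" using v by (simp add: dot_square_norm)
        ultimately have "a - (2 * (a \<bullet> v)) *\<^sub>R v = - a" by (simp add: hrefl_def)
        then have "2 *\<^sub>R a = 2 *\<^sub>R ((a \<bullet> v) *\<^sub>R v)" by (simp add: algebra_simps scaleR_2)
        then have eq: "a = (a \<bullet> v) *\<^sub>R v" by (rule scaleR_left_imp_eq[rotated]) simp
        then have "norm a = \<bar>a \<bullet> v\<bar> * norm v" by (metis norm_scaleR)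
        then have "\<bar>a \<bullet> v\<bar> = 1" using a v by simp
        then have "a \<bullet> v = 1 \<or> a \<bullet> v = -1" by linarith
        then have "a = v \<or> a = - v" using eq by (metis scaleR_minus1_left scaleR_one)
        then show ?thesis by auto
      qed
      then have "{v \<in> \<Sigma>. norm v = 1 \<and> (\<forall>u\<in>\<Sigma>. r u = hrefl v u)} \<subseteq> {a, - a}" by blast
      then show ?thesis by (rule finite_subset) simp
    next
      case True
      then show ?thesis by (simp only: finite.emptyI)
    qed
    show ?thesis by (rule finite_subset[OF sub finite_UN_I[OF finR fin]])
  qed
  have "0 \<notin> \<Phi>" by (simp add: \<Phi>_def)
  then obtain \<rho> where \<rho>: "\<forall>a\<in>\<Phi>. \<rho> \<bullet> a \<noteq> 0" using exists_regular_vector[OF fin\<Phi>] by blast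
  interpret root_set \<Phi> \<rho>
  proof
    show "finite \<Phi>" by (rule fin\<Phi>)
    show "norm a = 1" if "a \<in> \<Phi>" for a using that by (simp add: \<Phi>_def)
    show "\<rho> \<bullet> a \<noteq> 0" if "a \<in> \<Phi>" for a using that \<rho> by blast
    show "hrefl a b \<in> \<Phi>" if ab: "a \<in> \<Phi>" "b \<in> \<Phi>" for a b
    proof -
      obtain w v where w: "w \<in> ?W" "\<forall>u\<in>\<Sigma>. w u = hrefl a u" and v: "v \<in> ?W" "\<forall>u\<in>\<Sigma>. v u = hrefl b u"
        using ab by (auto simp: \<Phi>_def)
      have "\<forall>u\<in>\<Sigma>. (w \<circ> (v \<circ> w)) u = hrefl (hrefl a b) u"
        using w v WS[OF w(1)] WS[OF v(1)] by (simp add: hrefl_conj)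
      moreover have "w \<circ> (v \<circ> w) \<in> ?W" by (intro compW w v)
      moreover have "hrefl a b \<in> \<Sigma>" "norm (hrefl a b) = 1"
        using ab S by (auto simp: \<Phi>_def hrefl_in_subspace)
      ultimately show ?thesis unfolding \<Phi>_def by blast
    qed
  qed
  have refl_orb: "hrefl a z \<in> orb ?W x" if h: "a \<in> \<Phi>" "z \<in> orb ?W x" "x \<in> \<Sigma>" for a z x
  proof -
    obtain w where w: "w \<in> ?W" "\<forall>u\<in>\<Sigma>. w u = hrefl a u" using h(1) by (auto simp: \<Phi>_def)
    obtain v where v: "v \<in> ?W" "z = v x" using h(2) by (auto simp: orb_def)
    have "hrefl a z = (w \<circ> v) x" using w v WS[OF v(1)] h by simp
    then show ?thesis using compW[OF w(1) v(1)] unfolding orb_def by blast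
  qed
  have gen_word: "\<exists>as. set as \<subseteq> \<Phi> \<and> (\<forall>u\<in>\<Sigma>. f u = refl_word as u)" if "f \<in> generated_on \<Sigma> T" for f
    using that
  proof induction
    case gen_id
    then show ?case by (intro exI[of _ "[]"]) simp
  next
    case (gen_step f s)
    obtain as where as: "set as \<subseteq> \<Phi>" "\<forall>u\<in>\<Sigma>. f u = refl_word as u" using gen_step by blast
    obtain v where v: "v \<in> \<Sigma>" "v \<noteq> 0" "s = restrict (hrefl v) \<Sigma>"
      using T[OF gen_step(2)] by (auto simp: is_reflection_on_def hrefl_def[abs_def])
    define a where "a = (1 / norm v) *\<^sub>R v"
    have ha: "hrefl a = hrefl v" using v(2)
      by (simp add: hrefl_def fun_eq_iff a_def power2_norm_eq_inner[symmetric] power2_eq_square field_simps)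
    \<comment> \<open>The one-letter word shows that the generator \<open>s\<close> itself is the
      restriction of a Weyl element, so its normalized normal \<open>a\<close> is a root.\<close>
    have "restrict (s \<circ> restrict id \<Sigma>) \<Sigma> \<in> ?R"
      unfolding RT by (intro generated_on.intros gen_step)
    moreover have "restrict (s \<circ> restrict id \<Sigma>) \<Sigma> = s" using v by (auto simp: restrict_def)
    ultimately obtain w where w: "w \<in> ?W" "s = restrict w \<Sigma>" by auto
    have "\<forall>u\<in>\<Sigma>. w u = hrefl a u"
    proof
      fix u assume "u \<in> \<Sigma>"
      then show "w u = hrefl a u" using fun_cong[OF w(2), of u] v(3) ha by simp
    qed
    then have aP: "a \<in> \<Phi>" using w v S unfolding \<Phi>_def by (auto simp: a_def subspace_scale)
    have "restrict (s \<circ> f) \<Sigma> u = refl_word (a # as) u" if u: "u \<in> \<Sigma>" for u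
    proof -
      have "f \<in> ?R" unfolding RT by (rule gen_step)
      then have "f u \<in> \<Sigma>" using u WS by auto
      then show ?thesis using u v(3) ha as by simp
    qed
    then show ?case using as aP by (intro exI[of _ "a # as"]) auto
  qed
  have orb_word: "\<exists>as. set as \<subseteq> \<Phi> \<and> z = refl_word as x" if z: "z \<in> orb ?W x" "x \<in> \<Sigma>" for z x
  proof -
    obtain w where w: "w \<in> ?W" "z = w x" using z by (auto simp: orb_def)
    then have "restrict w \<Sigma> \<in> generated_on \<Sigma> T" using RT by blast
    then show ?thesis using gen_word w z by fastforce
  qed
  have fin_orb: "finite (orb ?W x)" if x: "x \<in> \<Sigma>" for x
  proof -
    have "orb ?W x = (\<lambda>f. f x) ` ?R" using x by (auto simp: orb_def image_image)
    then show ?thesis using finR by simp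
  qed
  have orb_eq: "orb ?W (w x) = orb ?W x" if w: "w \<in> ?W" for w x
  proof -
    have iw: "inv w \<in> ?W" by (rule invW[OF w])
    have "v (w x) \<in> orb ?W x" if "v \<in> ?W" for v
      using compW[OF that w] unfolding orb_def by (intro image_eqI[of _ _ "v \<circ> w"]) auto
    moreover have "v x \<in> orb ?W (w x)" if "v \<in> ?W" for v
      using compW[OF that iw] act(4)[OF WG[OF w]] unfolding orb_def
      by (intro image_eqI[of _ _ "v \<circ> inv w"]) auto
    ultimately show ?thesis by (auto simp: orb_def)
  qed
  have "\<exists>y. y \<in> X \<and> y \<in> chamber \<and> y \<in> \<Sigma> \<and> X = orb ?W y" if X: "X \<in> orb ?W ` \<Sigma>" for X
  proof -
    obtain x where x: "x \<in> \<Sigma>" "X = orb ?W x" using X by blast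
    have "x \<in> X" using idW x unfolding orb_def by (metis id_apply image_eqI)
    \<comment> \<open>A maximizer of \<open>\<rho>\<close> on the orbit lies in the chamber, since
      reflecting it in a violated positive root would increase the value.\<close>
    then obtain y where y: "y \<in> X" "\<And>z. z \<in> X \<Longrightarrow> \<rho> \<bullet> z \<le> \<rho> \<bullet> y"
      using finite_attains_max[of X "\<lambda>u. \<rho> \<bullet> u"] fin_orb[OF x(1)] x(2) by blast
    have "0 \<le> y \<bullet> a" if a: "a \<in> pos" for a
    proof (rule ccontr)
      assume n: "\<not> 0 \<le> y \<bullet> a"
      have a': "a \<in> \<Phi>" "\<rho> \<bullet> a > 0" using a by (auto simp: pos_def)
      have aa: "a \<bullet> a = 1" using norm_roots[OF a'(1)] by (simp add: dot_square_norm)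
      have "\<rho> \<bullet> hrefl a y \<le> \<rho> \<bullet> y" using y refl_orb[OF a'(1), of y x] x by blast
      moreover have "(y \<bullet> a) * (\<rho> \<bullet> a) < 0" using n a' by (simp add: mult_neg_pos)
      ultimately show False by (simp add: hrefl_def aa inner_diff_right mult.commute)
    qed
    then have "y \<in> chamber" by (simp add: chamber_def)
    moreover obtain w where w: "w \<in> ?W" "y = w x" using y x by (auto simp: orb_def)
    moreover have "X = orb ?W y" "y \<in> \<Sigma>" using x w orb_eq[OF w(1)] WS[OF w(1)] by auto
    ultimately show ?thesis using y by blast
  qed
  then obtain \<phi> where \<phi>: "\<And>X. X \<in> orb ?W ` \<Sigma> \<Longrightarrow> \<phi> X \<in> X \<and> \<phi> X \<in> chamber \<and> \<phi> X \<in> \<Sigma> \<and> X = orb ?W (\<phi> X)"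
    by metis
  have "qdist X Y = dist (\<phi> X) (\<phi> Y)" if X: "X \<in> orb ?W ` \<Sigma>" and Y: "Y \<in> orb ?W ` \<Sigma>" for X Y
  proof (rule qdist_eqI)
    let ?x = "\<phi> X" and ?y = "\<phi> Y"
    have x: "?x \<in> X" "?x \<in> chamber" "?x \<in> \<Sigma>" "X = orb ?W ?x" using \<phi>[OF X] by auto
    have y: "?y \<in> Y" "?y \<in> chamber" "?y \<in> \<Sigma>" "Y = orb ?W ?y" using \<phi>[OF Y] by auto
    show "?x \<in> X" "?y \<in> Y" by fact+
    fix p q assume "p \<in> X" "q \<in> Y"
    then have "p \<in> orb ?W ?x" "q \<in> orb ?W ?y" using x(4) y(4) by simp_all
    then obtain w v where w: "w \<in> ?W" "p = w ?x" and v: "v \<in> ?W" "q = v ?y"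
      unfolding orb_def by blast
    have "p \<bullet> q = ?x \<bullet> (inv w \<circ> v) ?y" using w v act(7)[OF WG[OF w(1)]] by simp
    moreover have "(inv w \<circ> v) ?y \<in> orb ?W ?y"
      unfolding orb_def by (intro imageI compW invW w v)
    then have "?x \<bullet> (inv w \<circ> v) ?y \<le> ?x \<bullet> ?y"
      using y(1,4) by (intro chamber_dominates[of "orb ?W ?y"] fin_orb refl_orb orb_word x(2) y(2,3)) simp_all
    ultimately have "p \<bullet> q \<le> ?x \<bullet> ?y" by simp
    then have "(dist ?x ?y)\<^sup>2 \<le> (dist p q)\<^sup>2"
      using act(2)[OF WG[OF w(1)], of ?x ?x] act(2)[OF WG[OF v(1)], of ?y ?y] w(2) v(2)
      by (simp add: dist_norm power2_norm_eq_inner inner_diff_left inner_diff_right inner_commute)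
    then show "dist ?x ?y \<le> dist p q" by (rule power2_le_imp_le) simp
  qed
  then show ?thesis by blast
qed

section \<open>From isometric embeddings of the quotient to positive definite kernels\<close>

lemma pd_kernel_onI_embedding:
  fixes \<psi> :: "'b \<Rightarrow> 'c::real_inner"
  assumes "\<And>X Y. X \<in> S \<Longrightarrow> Y \<in> S \<Longrightarrow> K X Y = \<psi> X \<bullet> \<psi> Y"
  shows "pd_kernel_on S K"
  unfolding pd_kernel_on_def
proof (intro conjI ballI allI impI)
  show "K X Y = K Y X" if "X \<in> S" "Y \<in> S" for X Y using assms that by (simp add: inner_commute)
  fix n :: nat and p :: "nat \<Rightarrow> 'b" and c :: "nat \<Rightarrow> real"
  assume p: "\<forall>i<n. p i \<in> S"
  have "(\<Sum>i<n. \<Sum>j<n. c i * c j * K (p i) (p j)) = (\<Sum>i<n. \<Sum>j<n. (c i *\<^sub>R \<psi> (p i)) \<bullet> (c j *\<^sub>R \<psi> (p j)))"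
    using p assms by (intro sum.cong refl) (simp add: mult.assoc)
  also have "\<dots> = (\<Sum>i<n. c i *\<^sub>R \<psi> (p i)) \<bullet> (\<Sum>j<n. c j *\<^sub>R \<psi> (p j))"
    unfolding inner_sum_left inner_sum_right by (rule sum.swap)
  finally show "0 \<le> (\<Sum>i<n. \<Sum>j<n. c i * c j * K (p i) (p j))" by simp
qed

text \<open>Take the image of the zero orbit as origin. Distances to it are norms, so polarization
  turns the formula for the squared quotient distance into an inner product representation of the
  kernel.\<close>

lemma (in closed_orbit_group) pd_kernel_if_isometric_embedding:
  fixes \<psi> :: "'a set \<Rightarrow> 'c::real_inner"
  assumes "\<And>X Y. X \<in> range (orb G) \<Longrightarrow> Y \<in> range (orb G) \<Longrightarrow> qdist X Y = dist (\<psi> X) (\<psi> Y)"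
  shows "pd_kernel_on (range (orb G)) maxfilt"
proof (rule pd_kernel_onI_embedding)
  fix X Y assume "X \<in> range (orb G)" "Y \<in> range (orb G)"
  then obtain x y where xy: "X = orb G x" "Y = orb G y" by blast
  define base where "base = \<psi> (orb G 0)"
  have d: "(dist (\<psi> (orb G a)) (\<psi> (orb G b)))\<^sup>2 = a \<bullet> a + b \<bullet> b - 2 * mf a b" for a b
    using qdist_orb[of a b] assms by simp
  have m0: "mf a 0 = 0" for a using mf_attained[of a 0] by auto
  have x0: "(norm (\<psi> X - base))\<^sup>2 = x \<bullet> x" and y0: "(norm (\<psi> Y - base))\<^sup>2 = y \<bullet> y"
    using d[of x 0] d[of y 0] m0 by (simp_all add: xy base_def dist_norm)
  have "(norm (\<psi> X - \<psi> Y))\<^sup>2 = x \<bullet> x + y \<bullet> y - 2 * mf x y" using d[of x y] by (simp add: xy dist_norm)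
  moreover have "(norm (\<psi> X - \<psi> Y))\<^sup>2 = (norm (\<psi> X - base))\<^sup>2 + (norm (\<psi> Y - base))\<^sup>2 - 2 * ((\<psi> X - base) \<bullet> (\<psi> Y - base))"
    by (simp add: power2_norm_eq_inner inner_diff_left inner_diff_right inner_commute)
  ultimately show "maxfilt X Y = (\<psi> X - \<psi> (orb G 0)) \<bullet> (\<psi> Y - \<psi> (orb G 0))"
    using x0 y0 by (simp add: xy mf_def base_def)
qed

theorem theorem38:
  fixes G :: "('a::euclidean_space \<Rightarrow> 'a) set"
  assumes "orth_group G"
    and "\<forall>x. closed (orb G x)"
  shows "pd_kernel_on (range (orb G)) maxfilt \<longleftrightarrow>
    (\<exists>\<Sigma>. is_section G \<Sigma> \<and>
       (\<exists>f. bij_betw f (range (orb G)) (orb (weyl G \<Sigma>) ` \<Sigma>) \<and>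
            (\<forall>A\<in>range (orb G). \<forall>B\<in>range (orb G). qdist (f A) (f B) = qdist A B)) \<and>
       finite_reflection_group_on \<Sigma> ((\<lambda>g. restrict g \<Sigma>) ` weyl G \<Sigma>))"
    (is "?pd \<longleftrightarrow> (\<exists>\<Sigma>. ?polar \<Sigma>)")
proof -
  interpret closed_orbit_group G
    using assms by unfold_locales auto
  show ?thesis
  proof
    assume ?pd
    then interpret pd_group G by unfold_locales
    obtain A where A: "max_aligned A"
      using max_aligned_extend[of "{}"] by (auto simp: aligned_set_def)
    interpret fundamental_cone G A by unfold_locales (rule A)
    show "\<exists>\<Sigma>. ?polar \<Sigma>"
      using section_Sigma quotient_isometry reflection_group_R by blast
  next
    assume "\<exists>\<Sigma>. ?polar \<Sigma>"
    then obtain \<Sigma> f where S: "is_section G \<Sigma>"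
      and f: "bij_betw f (range (orb G)) (orb (weyl G \<Sigma>) ` \<Sigma>)"
      and iso: "\<And>X Y. X \<in> range (orb G) \<Longrightarrow> Y \<in> range (orb G) \<Longrightarrow> qdist (f X) (f Y) = qdist X Y"
      and R: "finite_reflection_group_on \<Sigma> ((\<lambda>g. restrict g \<Sigma>) ` weyl G \<Sigma>)"
      by blast
    have "subspace \<Sigma>" using S by (simp add: is_section_def)
    then obtain \<phi> :: "'a set \<Rightarrow> 'a" where \<phi>: "\<And>X Y. X \<in> orb (weyl G \<Sigma>) ` \<Sigma> \<Longrightarrow>
        Y \<in> orb (weyl G \<Sigma>) ` \<Sigma> \<Longrightarrow> qdist X Y = dist (\<phi> X) (\<phi> Y)"
      using reflection_quotient_embedding[OF grp _ R] by blast
    have mem: "f X \<in> orb (weyl G \<Sigma>) ` \<Sigma>" if "X \<in> range (orb G)" for X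
      using bij_betwE[OF f] that by blast
    \<comment> \<open>Composing the given isometry with the choice of chamber representatives embeds
      the orbit space into the Euclidean space.\<close>
    show ?pd
    proof (rule pd_kernel_if_isometric_embedding[of "\<phi> \<circ> f"])
      show "qdist X Y = dist ((\<phi> \<circ> f) X) ((\<phi> \<circ> f) Y)"
        if "X \<in> range (orb G)" "Y \<in> range (orb G)" for X Y
        using iso[OF that] \<phi>[OF mem mem] that by simp
    qed
  qed
qed

end
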